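(* Let $f$, $A$ be as in the context, let $g=0$, $\tau_0=1$, $\beta_1>0$, and let $\{\bar x^k\}$ be generated by the algorithm for $g=0$ described in the context. (1) If $h:\mathbb{R}^m\to\mathbb{R}$ is proper, closed, convex and Lipschitz continuous, and $x^\star$ is an optimal solution of $F^\star=\min_{x\in\mathbb{R}^p}\{F(x)=f(x)+h(Ax)\}$, then with variant (L) of the algorithm, for all $k\ge1$, $$\mathbb{E}\left[F(\bar x^k)-F^\star\right]\le\frac1k\sum_{i=1}^n\frac{B_i^0}{2q_i^2}\|x_i^\star-x_i^0\|_{(i)}^2+\frac{\beta_1D_{h^*}^2}{k+1},\qquad D_{h^*}:=\sup_{y\in\mathrm{dom}(h^* )}\|y-\dot y\|<+\infty .$$ (2) If instead $h=\delta_{\{c\}}$ for some $c\in\mathbb{R}^m$, i.e. one solves $F^\star=\min_{x\in\mathbb{R}^p}\{F(x)=f(x)\mid Ax=c\}$, with $x^\star$ an optimal solution and $y^\star$ an optimal solution of the dual problem $\max_{y\in\mathbb{R}^m}\{\min_{x\in\mathbb{R}^p}F(x)+\langle Ax,y\rangle-\langle c,y\rangle\}$ (with strong duality holding, i.e. the optimal dual value equals $F^\star$), then with variant (C) of the algorithm, for all $k\ge1$, $$\mathbb{E}\left[F(\bar x^k)-F^\star\right]\le\frac{C^*(x^0)}{k}+\frac{\beta_1\|y^\star-\dot y\|^2}{2k}+\|y^\star\|\,\mathbb{E}\left[\|A\bar x^k-c\|\right],$$ $$\mathbb{E}\left[\|A\bar x^k-c\|\right]\le\frac{\beta_1}{k}\left[\|y^\star-\dot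 y\|+\left(\|y^\star-\dot y\|^2+2\beta_1^{-1}C^*(x^0)\right)^{1/2}\right],$$ where $C^*(x^0):=\sum_{i=1}^n\frac{B_i^0}{2q_i^2}\|x_i^\star-x_i^0\|_{(i)}^2$.
   Context: **Notation.** $[n]=\{1,\dots,n\}$. Vectors $x\in\mathbb{R}^p$ are split into $n$ blocks $x=[x_1;\dots;x_n]$ with $x_i\in\mathbb{R}^{p_i}$, $p_i\ge1$, $\sum_i p_i=p$; the identity is split as $\mathbb{I}_p=[U_1,\dots,U_n]$ with $U_i\in\mathbb{R}^{p\times p_i}$, so $x_i=U_i^\top x$; $\nabla_if(x)=U_i^\top\nabla f(x)$. For $A\in\mathbb{R}^{m\times p}$, $A_i=AU_i$ is its $i$-th column block. $\|\cdot\|$ is the Euclidean norm. For each $i$, $H_i\in\mathbb{R}^{p_i\times p_i}$ is a given symmetric positive definite matrix, $\|x_i\|_{(i)}^2=\langle H_ix_i,x_i\rangle$ and $(\|y_i\|_{(i)}^* )^2=\langle H_i^{-1}y_i,y_i\rangle$. $\|A_i\|$ is the operator norm of $A_i$ from $(\mathbb{R}^{p_i},\|\cdot\|_{(i)})$ to $(\mathbb{R}^m,\|\cdot\|)$. $h^*$ is the Fenchel conjugate of $h$; $\delta_{\{c\}}$ is the indicator function of $\{c\}$. **Assumptions on $f$.** $f:\mathbb{R}^p\to\mathbb{R}$ is convex and differentiable, and for each $i$ there is $\hat L_i\in[0,\infty)$ with $\|\nabla_if(x+U_id_i)-\nabla_if(x)\|_{(i)}^*\le\hat L_i\|d_i\|_{(i)}$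 for all $x\in\mathbb{R}^p$, $d_i\in\mathbb{R}^{p_i}$. **Smoothing.** Fix $\dot y\in\mathbb{R}^m$. For $\beta>0$, $y_\beta^*(u)$ is the unique maximizer over $y\in\mathbb{R}^m$ of $\langle u,y\rangle-h^*(y)-\frac{\beta}{2}\|y-\dot y\|^2$; for $h=\delta_{\{c\}}$ this is $y_\beta^*(u)=\dot y+\frac1\beta(u-c)$. **Algorithm for $g=0$.** Inputs: $\beta_1>0$, $\alpha\in[0,1]$, $x^0\in\mathbb{R}^p$. Set $B_i^0:=\hat L_i+\|A_i\|^2/\beta_1$ (assumed $>0$) for $i\in[n]$, $S_\alpha:=\sum_{i=1}^n(B_i^0)^\alpha$, $q_i:=(B_i^0)^\alpha/S_\alpha$, $\tau_0:=1$, $\bar x^0=\tilde x^0:=x^0$. For $k=0,1,2,\dots$: 1. $\hat x^k:=(1-\tau_k)\bar x^k+\tau_k\tilde x^k$ and $\hat u^k:=A\hat x^k$. 2. Draw $i_k\in[n]$ with $\mathbb{P}\{i_k=i\}=q_i$, independently of the previous draws. 3. Set $\tilde x^{k+1}:=\tilde x^k$ except for block $i_k$, where $\tilde x_{i_k}^{k+1}:=\tilde x_{i_k}^k-\frac{q_{i_k}}{\tau_kB_{i_k}^k}H_{i_k}^{-1}\left(\nabla_{i_k}f(\hat x^k)+A_{i_k}^\top y_{\beta_{k+1}}^*(\hat u^k)\right)$. 4. $\bar x_i^{k+1}:=\hat x_i^k+\frac{\tau_k}{q_i}(\tilde x_i^{k+1}-\tilde x_i^k)$ for all $i\in[n]$.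 5. Parameter update: in variant (L), $\tau_{k+1}\in(0,1)$ is the unique positive root of $\tau^3+\tau^2+\tau_k^2\tau-\tau_k^2=0$ and $\beta_{k+2}:=\beta_{k+1}/(1+\tau_{k+1})$; in variant (C), $\tau_{k+1}:=\tau_k/(1+\tau_k)$ and $\beta_{k+2}:=(1-\tau_{k+1})\beta_{k+1}$. 6. $B_i^{k+1}:=\hat L_i+\|A_i\|^2/\beta_{k+2}$ for $i\in[n]$. $\mathbb{E}$ is expectation over the random indices $i_0,i_1,\dots$. *)

theory Defs
  imports "HOL-Probability.Probability"
begin

text \<open>
  A splitting of \<open>real^'p\<close> into blocks indexed by \<open>'n\<close> is a map \<open>blk :: 'p \<Rightarrow> 'n\<close> assigning to every
  coordinate its block. The space of the \<open>i\<close>-th block vectors is identified with the coordinate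
  subspace \<open>block_space blk i\<close> of \<open>real^'p\<close> through the zero-padding map \<open>U\<^sub>i\<close>, so the block \<open>x\<^sub>i\<close> of
  \<open>x\<close> is represented by \<open>U\<^sub>i x\<^sub>i = U\<^sub>i U\<^sub>i\<^sup>T x\<close>, which is \<open>block_part blk i x\<close>. A matrix acting on the
  \<open>i\<close>-th block is likewise represented by the zero-padded matrix \<open>U\<^sub>i H\<^sub>i U\<^sub>i\<^sup>T\<close>. Inner products,
  and \<open>A\<^sub>i x\<^sub>i = A U\<^sub>i x\<^sub>i\<close>, are unaffected by the padding.
\<close>

definition block_space :: "('p::finite \<Rightarrow> 'n) \<Rightarrow> 'n \<Rightarrow> (real^'p) set" where
  "block_space blk i = {x. \<forall>j. blk j \<noteq> i \<longrightarrow> x $ j = 0}"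

definition block_part :: "('p::finite \<Rightarrow> 'n) \<Rightarrow> 'n \<Rightarrow> real^'p \<Rightarrow> real^'p" where
  "block_part blk i x = (\<chi> j. if blk j = i then x $ j else 0)"

definition block_spd :: "('p::finite \<Rightarrow> 'n) \<Rightarrow> 'n \<Rightarrow> real^'p^'p \<Rightarrow> bool" where
  "block_spd blk i Hi \<longleftrightarrow>
     (\<forall>j l. blk j \<noteq> i \<or> blk l \<noteq> i \<longrightarrow> Hi $ j $ l = 0) \<and>
     transpose Hi = Hi \<and>
     (\<forall>x\<in>block_space blk i. x \<noteq> 0 \<longrightarrow> 0 < (Hi *v x) \<bullet> x)"

text \<open>
  The padded matrix is singular on \<open>real^'p\<close>; \<open>H\<^sub>i\<^sup>-\<^sup>1\<close> is the inverse of its action on the block.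
\<close>

definition block_inv :: "('p::finite \<Rightarrow> 'n) \<Rightarrow> 'n \<Rightarrow> real^'p^'p \<Rightarrow> real^'p \<Rightarrow> real^'p" where
  "block_inv blk i Hi = inv_into (block_space blk i) (\<lambda>x. Hi *v x)"

definition block_norm :: "real^'p^'p \<Rightarrow> real^'p::finite \<Rightarrow> real" where
  "block_norm Hi x = sqrt ((Hi *v x) \<bullet> x)"

definition block_dual_norm :: "('p::finite \<Rightarrow> 'n) \<Rightarrow> 'n \<Rightarrow> real^'p^'p \<Rightarrow> real^'p \<Rightarrow> real" where
  "block_dual_norm blk i Hi y = sqrt (block_inv blk i Hi y \<bullet> y)"

text \<open>
  Operator norm of \<open>A\<^sub>i\<close> in the style of \<^const>\<open>onorm\<close>; the quotient at \<open>d = 0\<close> is \<open>0\<close>.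
\<close>

definition block_onorm ::
    "('p::finite \<Rightarrow> 'n) \<Rightarrow> 'n \<Rightarrow> real^'p^'p \<Rightarrow> real^'p^'m::finite \<Rightarrow> real" where
  "block_onorm blk i Hi A = (SUP d\<in>block_space blk i. norm (A *v d) / block_norm Hi d)"

definition fenchel_conj :: "('v::real_inner \<Rightarrow> ereal) \<Rightarrow> 'v \<Rightarrow> ereal" where
  "fenchel_conj h y = (SUP u. ereal (u \<bullet> y) - h u)"

definition edom :: "('v \<Rightarrow> ereal) \<Rightarrow> 'v set" where
  "edom h = {y. h y < \<infinity>}"

definition indicator_fun :: "'v set \<Rightarrow> 'v \<Rightarrow> ereal" where
  "indicator_fun S u = (if u \<in> S then 0 else \<infinity>)"

definition smoothed_argmax ::
    "('v::real_inner \<Rightarrow> ereal) \<Rightarrow> 'v \<Rightarrow> real \<Rightarrow> 'v \<Rightarrow> 'v" where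
  "smoothed_argmax h ydot \<beta> u =
     (THE y. is_arg_max
        (\<lambda>y. ereal (u \<bullet> y) - fenchel_conj h y - ereal (\<beta> / 2 * (norm (y - ydot))\<^sup>2)) (\<lambda>_. True) y)"

definition conj_dom_radius :: "('v::real_inner \<Rightarrow> ereal) \<Rightarrow> 'v \<Rightarrow> ereal" where
  "conj_dom_radius h ydot = (SUP y\<in>edom (fenchel_conj h). ereal (norm (y - ydot)))"

definition B_coef ::
    "('p::finite \<Rightarrow> 'n) \<Rightarrow> ('n \<Rightarrow> real^'p^'p) \<Rightarrow> real^'p^'m::finite \<Rightarrow> ('n \<Rightarrow> real) \<Rightarrow> real \<Rightarrow> 'n \<Rightarrow> real"
  where
  "B_coef blk H A L \<beta> i = L i + (block_onorm blk i (H i) A)\<^sup>2 / \<beta>"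

definition sampling_prob ::
    "('p::finite \<Rightarrow> 'n::finite) \<Rightarrow> ('n \<Rightarrow> real^'p^'p) \<Rightarrow> real^'p^'m::finite \<Rightarrow> ('n \<Rightarrow> real) \<Rightarrow>
     real \<Rightarrow> real \<Rightarrow> 'n \<Rightarrow> real" where
  "sampling_prob blk H A L \<beta>1 \<alpha> i =
     B_coef blk H A L \<beta>1 i powr \<alpha> / (\<Sum>l\<in>UNIV. B_coef blk H A L \<beta>1 l powr \<alpha>)"

text \<open>
  In the following, the smoothing parameters are stored with shifted index: the \<open>k\<close>-th entry of
  \<open>\<beta>\<close> is \<open>\<beta>\<^sub>k\<^sub>+\<^sub>1\<close>, the parameter used in iteration \<open>k\<close>.
\<close>

primrec tau_L :: "nat \<Rightarrow> real" where
  "tau_L 0 = 1"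
| "tau_L (Suc k) = (THE t. 0 < t \<and> t ^ 3 + t\<^sup>2 + (tau_L k)\<^sup>2 * t - (tau_L k)\<^sup>2 = 0)"

primrec beta_L :: "real \<Rightarrow> nat \<Rightarrow> real" where
  "beta_L \<beta>1 0 = \<beta>1"
| "beta_L \<beta>1 (Suc k) = beta_L \<beta>1 k / (1 + tau_L (Suc k))"

primrec tau_C :: "nat \<Rightarrow> real" where
  "tau_C 0 = 1"
| "tau_C (Suc k) = tau_C k / (1 + tau_C k)"

primrec beta_C :: "real \<Rightarrow> nat \<Rightarrow> real" where
  "beta_C \<beta>1 0 = \<beta>1"
| "beta_C \<beta>1 (Suc k) = (1 - tau_C (Suc k)) * beta_C \<beta>1 k"

text \<open>
  The pair of iterates (bar, tilde) after \<open>k\<close> steps along the sequence \<open>ix\<close> of drawn block indices;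
  \<open>gf\<close> is the gradient of \<open>f\<close>. The increment of \<open>xtil\<close> lies in the block space of the drawn
  index, so all the other blocks are unchanged.
\<close>

primrec smart_cd ::
    "('p::finite \<Rightarrow> 'n::finite) \<Rightarrow> ('n \<Rightarrow> real^'p^'p) \<Rightarrow> real^'p^'m::finite \<Rightarrow> ('n \<Rightarrow> real) \<Rightarrow>
     (real^'p \<Rightarrow> real^'p) \<Rightarrow> (real^'m \<Rightarrow> ereal) \<Rightarrow> real^'m \<Rightarrow> real \<Rightarrow> real^'p \<Rightarrow>
     (nat \<Rightarrow> real) \<Rightarrow> (nat \<Rightarrow> real) \<Rightarrow> (nat \<Rightarrow> 'n) \<Rightarrow> nat \<Rightarrow> (real^'p) \<times> (real^'p)" where
  "smart_cd blk H A L gf h ydot \<alpha> x0 \<tau> \<beta> ix 0 = (x0, x0)"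
| "smart_cd blk H A L gf h ydot \<alpha> x0 \<tau> \<beta> ix (Suc k) =
     (let (xbar, xtil) = smart_cd blk H A L gf h ydot \<alpha> x0 \<tau> \<beta> ix k;
          q = sampling_prob blk H A L (\<beta> 0) \<alpha>;
          xhat = (1 - \<tau> k) *\<^sub>R xbar + \<tau> k *\<^sub>R xtil;
          uhat = A *v xhat;
          i = ix k;
          xtil' = xtil - (q i / (\<tau> k * B_coef blk H A L (\<beta> k) i)) *\<^sub>R
            block_inv blk i (H i)
              (block_part blk i (gf xhat) +
               block_part blk i (transpose A *v smoothed_argmax h ydot (\<beta> k) uhat));
          xbar' = (\<chi> j. xhat $ j + \<tau> k / q (blk j) * (xtil' $ j - xtil $ j))
      in (xbar', xtil'))"

definition xbar_iter ::
    "('p::finite \<Rightarrow> 'n::finite) \<Rightarrow> ('n \<Rightarrow> real^'p^'p) \<Rightarrow> real^'p^'m::finite \<Rightarrow> ('n \<Rightarrow> real) \<Rightarrow>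
     (real^'p \<Rightarrow> real^'p) \<Rightarrow> (real^'m \<Rightarrow> ereal) \<Rightarrow> real^'m \<Rightarrow> real \<Rightarrow> real^'p \<Rightarrow>
     (nat \<Rightarrow> real) \<Rightarrow> (nat \<Rightarrow> real) \<Rightarrow> (nat \<Rightarrow> 'n) \<Rightarrow> nat \<Rightarrow> real^'p" where
  "xbar_iter blk H A L gf h ydot \<alpha> x0 \<tau> \<beta> ix k = fst (smart_cd blk H A L gf h ydot \<alpha> x0 \<tau> \<beta> ix k)"

definition C_star ::
    "('p::finite \<Rightarrow> 'n::finite) \<Rightarrow> ('n \<Rightarrow> real^'p^'p) \<Rightarrow> real^'p^'m::finite \<Rightarrow> ('n \<Rightarrow> real) \<Rightarrow>
     real \<Rightarrow> real \<Rightarrow> real^'p \<Rightarrow> real^'p \<Rightarrow> real" where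
  "C_star blk H A L \<beta>1 \<alpha> xs x0 =
     (\<Sum>i\<in>UNIV. B_coef blk H A L \<beta>1 i / (2 * (sampling_prob blk H A L \<beta>1 \<alpha> i)\<^sup>2) *
        (block_norm (H i) (block_part blk i xs - block_part blk i x0))\<^sup>2)"

text \<open>
  Dual objective of minimizing \<open>f x\<close> subject to \<open>A x = c\<close>; it may take the value \<open>-\<infinity>\<close>.
\<close>

definition dual_fun ::
    "(real^'p \<Rightarrow> real) \<Rightarrow> real^'p^'m::finite \<Rightarrow> real^'m \<Rightarrow> real^'m \<Rightarrow> ereal" where
  "dual_fun f A c y = (INF x. ereal (f x + (A *v x) \<bullet> y - c \<bullet> y))"

end

theory Submission
  imports Defs
begin

text \<open>
  Since \<open>g = 0\<close>, the algorithm is randomized block coordinate descent with Nesterov acceleration,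
  applied in iteration \<open>k\<close> to the smoothed objective \<open>F\<^sub>\<beta>(x) = f x + h\<^sub>\<beta>(A x)\<close>, where
  \<open>h\<^sub>\<beta>(u) = max\<^sub>y (u \<bullet> y - h\<^sup>*(y) - \<beta>/2 \<parallel>y - ydot\<parallel>\<^sup>2)\<close> and \<open>\<beta>\<close> decreases with \<open>k\<close>. The function \<open>h\<^sub>\<beta>\<close>
  has the \<open>1/\<beta>\<close>-Lipschitz gradient \<open>y\<^sub>\<beta>\<^sup>*\<close>, so along block \<open>i\<close> the gradient of \<open>F\<^sub>\<beta>\<close> is Lipschitz with
  constant \<open>B\<^sub>i = L\<^sub>i + \<parallel>A\<^sub>i\<parallel>\<^sup>2/\<beta>\<close>. The averaged point \<open>xbar\<close> moves from \<open>xhat\<close> by exactly one gradient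
  step of length \<open>1/B\<^sub>i\<close>, which gains \<open>\<parallel>g\<^sub>i\<parallel>\<^sup>2/(2 B\<^sub>i)\<close> in the dual block norm (\<open>smoothed_obj_block_step\<close>),
  while the squared distance of \<open>xtil\<close> to the solution, weighted by \<open>\<tau>\<^sup>2 B\<^sub>i/(2 q\<^sub>i\<^sup>2)\<close>, grows by the same
  amount plus a linear term (\<open>weighted_dist_block_step\<close>). The two quadratic terms cancel whichever block
  is drawn, and averaging over the draw turns the linear terms into \<open>- \<tau> g \<bullet> (xtil - xs)\<close>.

  Convexity then bounds this by a mixture, with weights \<open>\<tau>\<close> and \<open>1 - \<tau>\<close>, of the optimal value and of
  the previous smoothed value at \<open>xbar\<close>. The tangent of \<open>h\<^sub>\<beta>\<close> lies below \<open>h\<close> by at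
  least \<open>\<beta>/2 \<parallel>y\<^sub>\<beta>\<^sup>* - ydot\<parallel>\<^sup>2\<close>, and this slack pays for the change of \<open>\<beta>\<close> since
  \<open>(1 - \<tau>\<^sub>k) \<beta>\<^sub>k \<le> \<beta>\<^sub>k\<^sub>+\<^sub>1\<close> (\<open>expected_step\<close>). As \<open>\<tau>\<^sub>k\<^sup>2 B\<^sub>i\<^sup>k\<close> decreases at least by the factor \<open>1 - \<tau>\<^sub>k\<close>, the
  expected sum of smoothed gap and weighted distance is at most \<open>1 - \<tau>\<^sub>k\<close> times its previous value, and
  \<open>\<tau>\<^sub>0 = 1\<close> makes its initial value \<open>C\<^sup>*(x\<^sup>0)\<close> (\<open>expected_smoothed_gap\<close>). Both parameter
  rules make the product of the factors at most \<open>1/k\<close>.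

  It remains to compare \<open>F\<^sub>\<beta>\<close> with the original problem. In the Lipschitz case \<open>h \<le> h\<^sub>\<beta> + \<beta>/2 D\<^sup>2\<close>
  (\<open>le_smoothed\<close>), and \<open>\<beta>\<^sub>k \<le> 2 \<beta>\<^sub>1/(k + 1)\<close>. In the constrained case \<open>h\<^sub>\<beta>\<close> is an explicit quadratic
  in the residual \<open>r = A x - c\<close>; bounding \<open>F\<^sub>\<beta>\<close> below by the saddle point inequality of the dual
  solution gives \<open>\<parallel>r\<parallel>\<^sup>2/(2\<beta>) - \<parallel>ys - ydot\<parallel> \<parallel>r\<parallel> \<le> F\<^sub>\<beta> - F\<^sup>*\<close>, and with Jensen's inequality a
  quadratic inequality for \<open>E \<parallel>r\<parallel>\<close>.
\<close>

section \<open>Norms on coordinate blocks\<close>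

lemma block_part_in_space: "block_part blk i x \<in> block_space blk i"
  by (simp add: block_part_def block_space_def)

lemma block_part_id: "x \<in> block_space blk i \<Longrightarrow> block_part blk i x = x"
  by (auto simp: block_part_def block_space_def vec_eq_iff)

lemma block_part_other: "x \<in> block_space blk i \<Longrightarrow> l \<noteq> i \<Longrightarrow> block_part blk l x = 0"
  by (auto simp: block_part_def block_space_def vec_eq_iff)

lemma block_part_add: "block_part blk i (x + y) = block_part blk i x + block_part blk i y"
  by (auto simp: block_part_def vec_eq_iff)

lemma block_part_diff: "block_part blk i (x - y) = block_part blk i x - block_part blk i y"
  by (auto simp: block_part_def vec_eq_iff)

lemma block_part_inner_space:
  assumes "d \<in> block_space blk i" shows "block_part blk i y \<bullet> d = y \<bullet> d"
  using assms unfolding inner_vec_def block_part_def block_space_def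
  by (intro sum.cong) auto

lemma inner_block_part_space:
  assumes "d \<in> block_space blk i" shows "d \<bullet> block_part blk i y = d \<bullet> y"
  using block_part_inner_space [OF assms] by (simp add: inner_commute)

lemma sum_block_parts: "(\<Sum>i\<in>UNIV. block_part blk (i::'n::finite) x) = x"
  by (auto simp: vec_eq_iff block_part_def)

lemma subspace_block_space: "subspace (block_space blk i)"
  by (auto simp: subspace_def block_space_def)

lemma sum_block_inner:
  "(\<Sum>i\<in>UNIV. block_part blk (i::'n::finite) g \<bullet> block_part blk i x) = g \<bullet> x"
proof -
  have "(\<Sum>i\<in>UNIV. block_part blk i g \<bullet> block_part blk i x) = (\<Sum>i\<in>UNIV. g \<bullet> block_part blk i x)"
    by (intro sum.cong refl block_part_inner_space block_part_in_space)
  also have "\<dots> = g \<bullet> x"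
    by (simp add: inner_sum_right [symmetric] sum_block_parts)
  finally show ?thesis .
qed

context
  fixes blk :: "'p::finite \<Rightarrow> 'n" and i :: 'n and K :: "real^'p^'p"
  assumes spd: "block_spd blk i K"
begin

lemma block_matrix_range: "K *v x \<in> block_space blk i"
  using spd by (auto simp: block_spd_def block_space_def matrix_vector_mult_def)

lemma block_matrix_sym: "(K *v x) \<bullet> y = x \<bullet> (K *v y)"
proof -
  have "transpose K = K" using spd by (simp add: block_spd_def)
  then show ?thesis by (metis dot_lmul_matrix vector_transpose_matrix)
qed

lemma block_form_nonneg: "x \<in> block_space blk i \<Longrightarrow> 0 \<le> (K *v x) \<bullet> x"
  using spd by (cases "x = 0") (auto simp: block_spd_def less_imp_le)

text \<open>
  The padded matrix vanishes outside the block, but filling the complementary coordinates with the identity makes it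
  injective on the whole space, hence surjective; preimages of block vectors are block vectors.
\<close>

lemma block_matrix_bij: "bij_betw (\<lambda>x. K *v x) (block_space blk i) (block_space blk i)"
proof -
  define T where "T = (\<lambda>x. K *v x + (x - block_part blk i x))"
  have lin: "linear T"
    unfolding T_def
    by (intro linearI)
       (auto simp: block_part_def vec_eq_iff matrix_vector_right_distrib
          matrix_vector_mult_scaleR algebra_simps)
  have part: "block_part blk i (T x) = K *v x" for x
    using block_part_id [OF block_matrix_range]
    by (simp add: T_def block_part_add block_part_diff block_part_id block_part_in_space)
  have zero: "x = 0" if "x \<in> block_space blk i" "K *v x = 0" for x
    using that spd by (metis block_spd_def inner_zero_left less_irrefl)
  have inj: "inj T"
    unfolding linear_injective_0 [OF lin]
  proof safe
    fix x assume "T x = 0"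
    moreover have "block_part blk i 0 = 0" by (simp add: block_part_def vec_eq_iff)
    then have "K *v x = 0" using part [of x] \<open>T x = 0\<close> by simp
    ultimately have "x = block_part blk i x" by (simp add: T_def)
    then show "x = 0" using zero \<open>K *v x = 0\<close> block_part_in_space by metis
  qed
  have surj: "surj T" by (rule linear_inj_imp_surj [OF lin inj])
  show ?thesis
  proof (rule bij_betw_imageI)
    show "inj_on ((*v) K) (block_space blk i)"
    proof (rule inj_onI)
      fix x y assume "x \<in> block_space blk i" "y \<in> block_space blk i" "K *v x = K *v y"
      then have "x - y \<in> block_space blk i" "K *v (x - y) = 0"
        by (simp_all add: subspace_diff [OF subspace_block_space] matrix_vector_mult_diff_distrib)
      then show "x = y" using zero by fastforce
    qed
    show "(*v) K ` block_space blk i = block_space blk i"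
    proof (intro equalityI subsetI)
      fix y assume y: "y \<in> block_space blk i"
      obtain x where x: "T x = y" using surj by (metis surjD)
      have K: "K *v x = y" using part [of x] x block_part_id [OF y] by simp
      then have "x - block_part blk i x = 0" using x by (simp add: T_def)
      then have "x \<in> block_space blk i" using block_part_in_space [of blk i x] by simp
      then show "y \<in> (*v) K ` block_space blk i" using K by blast
    qed (use block_matrix_range in auto)
  qed
qed

lemma block_inv_in_space: "y \<in> block_space blk i \<Longrightarrow> block_inv blk i K y \<in> block_space blk i"
  unfolding block_inv_def using block_matrix_bij by (metis bij_betw_def inv_into_into)

lemma block_matrix_inv: "y \<in> block_space blk i \<Longrightarrow> K *v block_inv blk i K y = y"
  unfolding block_inv_def using block_matrix_bij
  by (metis bij_betw_inv_into_right)

lemma block_norm_sq: "x \<in> block_space blk i \<Longrightarrow> (block_norm K x)\<^sup>2 = (K *v x) \<bullet> x"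
  by (simp add: block_norm_def block_form_nonneg)

lemma block_norm_diff_scaled:
  assumes "x \<in> block_space blk i" "z \<in> block_space blk i"
  shows "(block_norm K (x - s *\<^sub>R z))\<^sup>2
    = (block_norm K x)\<^sup>2 - 2 * s * ((K *v z) \<bullet> x) + s\<^sup>2 * ((K *v z) \<bullet> z)"
proof -
  have "x - s *\<^sub>R z \<in> block_space blk i"
    using assms by (simp add: subspace_block_space subspace_diff subspace_scale)
  then have "(block_norm K (x - s *\<^sub>R z))\<^sup>2 = (K *v (x - s *\<^sub>R z)) \<bullet> (x - s *\<^sub>R z)"
    by (rule block_norm_sq)
  also have "\<dots> = (K *v x) \<bullet> x - 2 * s * ((K *v z) \<bullet> x) + s\<^sup>2 * ((K *v z) \<bullet> z)"
    using block_matrix_sym [of x z]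
    by (simp add: matrix_vector_mult_diff_distrib matrix_vector_mult_scaleR inner_diff_left
        inner_diff_right algebra_simps power2_eq_square inner_commute)
  finally show ?thesis by (simp add: block_norm_sq assms)
qed

lemma block_form_Cauchy_Schwarz:
  assumes x: "x \<in> block_space blk i" and z: "z \<in> block_space blk i"
  shows "\<bar>(K *v z) \<bullet> x\<bar> \<le> block_norm K z * block_norm K x"
proof -
  define a b c where "a = (K *v z) \<bullet> z" and "b = (K *v z) \<bullet> x" and "c = (K *v x) \<bullet> x"
  have q: "0 \<le> c - 2 * s * b + s\<^sup>2 * a" for s
    using block_norm_diff_scaled [OF x z, of s] zero_le_power2 [of "block_norm K (x - s *\<^sub>R z)"]
    by (simp add: a_def b_def c_def block_norm_sq x)
  have a0: "0 \<le> a" unfolding a_def by (rule block_form_nonneg [OF z])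
  have "b\<^sup>2 \<le> a * c"
  proof (cases "a = 0")
    case True
    have "z = 0" using True z spd by (force simp: a_def block_spd_def)
    then have "b = 0" by (simp add: b_def)
    then show ?thesis using True by simp
  next
    case False
    then have "a > 0" using a0 by simp
    from q [of "b / a"] have "0 \<le> (c - 2 * (b / a) * b + (b / a)\<^sup>2 * a) * a" 
      using \<open>a > 0\<close> by simp
    also have "\<dots> = c * a - b\<^sup>2" using \<open>a > 0\<close> by (simp add: field_simps power2_eq_square)
    finally show ?thesis by (simp add: mult.commute)
  qed
  then have "sqrt (b\<^sup>2) \<le> sqrt (a * c)" by (rule real_sqrt_le_mono)
  then show ?thesis by (simp add: a_def b_def c_def block_norm_def real_sqrt_mult)
qed

text \<open>
  With \<open>z = H\<^sub>i\<^sup>-\<^sup>1 y\<close> one has \<open>y \<bullet> d = (H\<^sub>i z) \<bullet> d\<close>, and the dual norm of \<open>y\<close> is the block norm of \<open>z\<close>.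
\<close>

lemma block_dual_norm_Cauchy_Schwarz:
  assumes y: "y \<in> block_space blk i" and d: "d \<in> block_space blk i"
  shows "\<bar>y \<bullet> d\<bar> \<le> block_dual_norm blk i K y * block_norm K d"
  using block_form_Cauchy_Schwarz [OF d block_inv_in_space [OF y]]
  by (simp add: block_matrix_inv [OF y] block_dual_norm_def block_norm_def inner_commute)

lemma block_norm_nonneg: "d \<in> block_space blk i \<Longrightarrow> 0 \<le> block_norm K d"
  by (simp add: block_norm_def block_form_nonneg)

text \<open>
  The supremum defining the operator norm is one of reals, so it bounds its members only once the
  quotients are known to be bounded; the dual norms of the rows of \<open>A\<close> provide such a bound.
\<close>

lemma norm_mult_le_block_onorm:
  fixes A :: "real^'p^'m::finite"
  assumes d: "d \<in> block_space blk i"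
  shows "norm (A *v d) \<le> block_onorm blk i K A * block_norm K d"
proof -
  define c where "c j = block_dual_norm blk i K (block_part blk i (A $ j))" for j
  have le: "norm (A *v e) \<le> (\<Sum>j\<in>UNIV. c j) * block_norm K e" if e: "e \<in> block_space blk i" for e
  proof -
    have "norm (A *v e) \<le> (\<Sum>j\<in>UNIV. \<bar>(A *v e) $ j\<bar>)" by (rule norm_le_l1_cart)
    also have "\<dots> \<le> (\<Sum>j\<in>UNIV. c j * block_norm K e)"
    proof (rule sum_mono)
      fix j
      have "(A *v e) $ j = block_part blk i (A $ j) \<bullet> e"
        by (simp add: block_part_inner_space [OF e] matrix_vector_mul_component)
      then show "\<bar>(A *v e) $ j\<bar> \<le> c j * block_norm K e"
        unfolding c_def using block_dual_norm_Cauchy_Schwarz [OF block_part_in_space e] by simp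
    qed
    finally show ?thesis by (simp add: sum_distrib_right)
  qed
  have pos: "0 < block_norm K e" if "e \<in> block_space blk i" "e \<noteq> 0" for e
    using that spd by (simp add: block_norm_def block_spd_def)
  have "bdd_above ((\<lambda>d. norm (A *v d) / block_norm K d) ` block_space blk i)"
  proof (rule bdd_aboveI2)
    fix e assume e: "e \<in> block_space blk i"
    show "norm (A *v e) / block_norm K e \<le> \<bar>\<Sum>j\<in>UNIV. c j\<bar>"
    proof (cases "e = 0")
      case False
      have "(\<Sum>j\<in>UNIV. c j) * block_norm K e \<le> \<bar>\<Sum>j\<in>UNIV. c j\<bar> * block_norm K e"
        using pos [OF e False] by (intro mult_right_mono) auto
      then have "norm (A *v e) \<le> \<bar>\<Sum>j\<in>UNIV. c j\<bar> * block_norm K e" using le [OF e] by linarith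
      then show ?thesis using pos [OF e False] by (simp add: divide_le_eq)
    qed auto
  qed
  then have "norm (A *v d) / block_norm K d \<le> block_onorm blk i K A"
    unfolding block_onorm_def by (rule cSUP_upper [OF d])
  then show ?thesis
    using pos [OF d] by (cases "d = 0") (auto simp: divide_le_eq block_norm_def)
qed

end

section \<open>Convexity and descent along a block\<close>

lemma convex_gradient_lower_bound:
  fixes f :: "'a::real_inner \<Rightarrow> real"
  assumes "convex_on UNIV f" "GDERIV f x :> g"
  shows "f x + g \<bullet> (y - x) \<le> f y"
proof -
  have d: "((\<lambda>t. f (x + t *\<^sub>R (y - x))) has_real_derivative (g \<bullet> (y - x))) (at 0)"
  proof -
    have "(f has_derivative (\<lambda>h. h \<bullet> g)) (at (x + 0 *\<^sub>R (y - x)))"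
      using assms(2) by (simp add: gderiv_def)
    then have "((\<lambda>t. f (x + t *\<^sub>R (y - x))) has_derivative (\<lambda>t. (t *\<^sub>R (y - x)) \<bullet> g)) (at 0)"
      by (rule has_derivative_compose [rotated]) (auto intro!: derivative_eq_intros)
    then show ?thesis
      by (rule has_derivative_imp_has_field_derivative) (simp add: inner_commute)
  qed
  have "convex_on UNIV (\<lambda>t. f (x + t *\<^sub>R (y - x)))"
  proof (rule convex_onI)
    fix t a b :: real assume t: "0 < t" "t < 1"
    have "f ((1 - t) *\<^sub>R (x + a *\<^sub>R (y - x)) + t *\<^sub>R (x + b *\<^sub>R (y - x)))
      \<le> (1 - t) * f (x + a *\<^sub>R (y - x)) + t * f (x + b *\<^sub>R (y - x))"
      using assms(1) t by (intro convex_onD) auto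
    then show "f (x + ((1 - t) *\<^sub>R a + t *\<^sub>R b) *\<^sub>R (y - x))
      \<le> (1 - t) * f (x + a *\<^sub>R (y - x)) + t * f (x + b *\<^sub>R (y - x))"
      by (simp add: algebra_simps)
  qed auto
  then have "f (x + 1 *\<^sub>R (y - x)) - f (x + 0 *\<^sub>R (y - x)) \<ge> (g \<bullet> (y - x)) * (1 - 0)"
    by (rule convex_on_imp_above_tangent) (use d in auto)
  then show ?thesis by simp
qed

text \<open>
  The usual descent lemma: by the Lipschitz condition, the function minus its quadratic upper model is
  nonincreasing along the ray from \<open>x\<close> in the direction \<open>d\<close>.
\<close>

lemma block_descent:
  fixes f :: "real^'p::finite \<Rightarrow> real"
  assumes spd: "block_spd blk i K"
    and grad: "\<And>x. GDERIV f x :> gf x"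
    and smooth: "\<And>x d. d \<in> block_space blk i \<Longrightarrow>
      block_dual_norm blk i K (block_part blk i (gf (x + d)) - block_part blk i (gf x))
        \<le> l * block_norm K d"
    and d: "d \<in> block_space blk i"
  shows "f (x + d) \<le> f x + gf x \<bullet> d + l / 2 * (block_norm K d)\<^sup>2"
proof -
  define \<psi> where "\<psi> t = f (x + t *\<^sub>R d) - t * (gf x \<bullet> d) - l * t\<^sup>2 / 2 * (block_norm K d)\<^sup>2" for t
  have deriv: "(\<psi> has_real_derivative
      (gf (x + t *\<^sub>R d) \<bullet> d - gf x \<bullet> d - l * t * (block_norm K d)\<^sup>2)) (at t)" for t
  proof -
    have "(f has_derivative (\<lambda>h. h \<bullet> gf (x + t *\<^sub>R d))) (at (x + t *\<^sub>R d))"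
      using grad by (simp add: gderiv_def)
    then have "((\<lambda>t. f (x + t *\<^sub>R d)) has_derivative (\<lambda>s. (s *\<^sub>R d) \<bullet> gf (x + t *\<^sub>R d))) (at t)"
      by (rule has_derivative_compose [rotated]) (auto intro!: derivative_eq_intros)
    then have *: "((\<lambda>t. f (x + t *\<^sub>R d)) has_real_derivative (gf (x + t *\<^sub>R d) \<bullet> d)) (at t)"
      by (rule has_derivative_imp_has_field_derivative) (simp add: inner_commute)
    show ?thesis unfolding \<psi>_def
      by (rule derivative_eq_intros * refl | simp)+
  qed
  have nonpos: "gf (x + t *\<^sub>R d) \<bullet> d - gf x \<bullet> d - l * t * (block_norm K d)\<^sup>2 \<le> 0" if "0 \<le> t" for t
  proof -
    have td: "t *\<^sub>R d \<in> block_space blk i" using d by (simp add: subspace_block_space subspace_scale)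
    have nt: "block_norm K (t *\<^sub>R d) = t * block_norm K d"
      using that by (simp add: block_norm_def matrix_vector_mult_scaleR real_sqrt_mult)
    let ?y = "block_part blk i (gf (x + t *\<^sub>R d)) - block_part blk i (gf x)"
    have y: "?y \<in> block_space blk i"
      by (simp add: subspace_block_space subspace_diff block_part_in_space)
    have "gf (x + t *\<^sub>R d) \<bullet> d - gf x \<bullet> d = ?y \<bullet> d"
      by (simp add: inner_diff_left block_part_inner_space d)
    also have "\<dots> \<le> block_dual_norm blk i K ?y * block_norm K d"
      using block_dual_norm_Cauchy_Schwarz [OF spd y d] by simp
    also have "\<dots> \<le> l * (t * block_norm K d) * block_norm K d"
      using smooth [OF td, of x] block_norm_nonneg [OF spd d]
      by (intro mult_right_mono) (auto simp: nt)
    finally show ?thesis by (simp add: power2_eq_square mult.assoc)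
  qed
  have "\<psi> 1 \<le> \<psi> 0"
    by (rule DERIV_nonpos_imp_nonincreasing) (use deriv nonpos in \<open>auto intro!: exI\<close>)
  then show ?thesis by (simp add: \<psi>_def)
qed

section \<open>Smoothing through the conjugate\<close>

text \<open>
  The common interface of the two cases. The set \<open>Q\<close> stands for the domain of the conjugate of \<open>h\<close>, and
  \<open>hs\<close> for the conjugate as a real function there. The maximized function is \<open>\<beta>\<close>-strongly concave, so it drops
  quadratically away from its maximizer. This property carries all later estimates, in
  particular the smoothness of the maximum as a function of \<open>u\<close>.
\<close>

locale smoothed_conjugate =
  fixes h :: "'v::real_inner \<Rightarrow> ereal" and ydot :: 'v and Q :: "'v set" and hs :: "'v \<Rightarrow> real"
  assumes argmax_in: "0 < \<beta> \<Longrightarrow> smoothed_argmax h ydot \<beta> u \<in> Q"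
    and argmax_gap: "\<lbrakk>0 < \<beta>; y \<in> Q\<rbrakk> \<Longrightarrow>
      u \<bullet> y - hs y - \<beta> / 2 * (norm (y - ydot))\<^sup>2
        + \<beta> / 2 * (norm (y - smoothed_argmax h ydot \<beta> u))\<^sup>2
      \<le> u \<bullet> smoothed_argmax h ydot \<beta> u - hs (smoothed_argmax h ydot \<beta> u)
        - \<beta> / 2 * (norm (smoothed_argmax h ydot \<beta> u - ydot))\<^sup>2"
begin

abbreviation ymax :: "real \<Rightarrow> 'v \<Rightarrow> 'v" where
  "ymax \<equiv> smoothed_argmax h ydot"

definition smoothed :: "real \<Rightarrow> 'v \<Rightarrow> real" where
  "smoothed \<beta> u = u \<bullet> ymax \<beta> u - hs (ymax \<beta> u) - \<beta> / 2 * (norm (ymax \<beta> u - ydot))\<^sup>2"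

lemma smoothed_ge:
  assumes "0 < \<beta>" "y \<in> Q"
  shows "u \<bullet> y - hs y - \<beta> / 2 * (norm (y - ydot))\<^sup>2 \<le> smoothed \<beta> u"
proof -
  have "0 \<le> \<beta> / 2 * (norm (y - ymax \<beta> u))\<^sup>2" using assms by simp
  then show ?thesis using argmax_gap [OF assms, of u] by (simp add: smoothed_def)
qed

text \<open>
  Compare the maximizers \<open>y\<close> at \<open>u\<close> and \<open>z\<close> at \<open>u + d\<close>: replacing \<open>z\<close> by \<open>y\<close> in the problem at \<open>u\<close> wins
  \<open>\<beta>/2 \<parallel>z - y\<parallel>\<^sup>2\<close>, which absorbs the cross term \<open>d \<bullet> (z - y)\<close> up to \<open>\<parallel>d\<parallel>\<^sup>2/(2\<beta>)\<close>. So \<open>ymax \<beta>\<close> acts as the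
  gradient of the smoothed function, with Lipschitz constant \<open>1/\<beta>\<close>.
\<close>

lemma smoothed_descent:
  assumes \<beta>: "0 < \<beta>"
  shows "smoothed \<beta> (u + d) \<le> smoothed \<beta> u + ymax \<beta> u \<bullet> d + (norm d)\<^sup>2 / (2 * \<beta>)"
proof -
  let ?y = "ymax \<beta> u" and ?z = "ymax \<beta> (u + d)"
  have "smoothed \<beta> (u + d) = u \<bullet> ?z - hs ?z - \<beta> / 2 * (norm (?z - ydot))\<^sup>2 + d \<bullet> ?z"
    by (simp add: smoothed_def inner_add_left)
  also have "\<dots> \<le> smoothed \<beta> u - \<beta> / 2 * (norm (?z - ?y))\<^sup>2 + d \<bullet> ?z"
    using argmax_gap [OF \<beta> argmax_in [OF \<beta>], of u "u + d"] by (simp add: smoothed_def)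
  also have "\<dots> \<le> smoothed \<beta> u + ?y \<bullet> d + (norm d)\<^sup>2 / (2 * \<beta>)"
  proof -
    have "0 \<le> (norm (d - \<beta> *\<^sub>R (?z - ?y)))\<^sup>2 / (2 * \<beta>)" using \<beta> by simp
    also have "\<dots> = (norm d)\<^sup>2 / (2 * \<beta>) - d \<bullet> (?z - ?y) + \<beta> / 2 * (norm (?z - ?y))\<^sup>2"
      using \<beta> by (simp add: power2_norm_eq_inner inner_diff_left [of d] inner_diff_right [of _ d]
        inner_commute [of "?z - ?y" d]) (simp add: field_simps power2_eq_square)
    finally show ?thesis by (simp add: inner_diff_right inner_commute)
  qed
  finally show ?thesis .
qed

text \<open>
  A tangent of the smoothed function is the affine function belonging to the maximizer at the point of
  tangency; hence the two bounds on tangents below follow by inserting this one \<open>y\<close> into the maxima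
  that define the functions on the right.
\<close>

lemma smoothed_linear_part:
  "smoothed \<beta> u + ymax \<beta> u \<bullet> (v - u)
    = v \<bullet> ymax \<beta> u - hs (ymax \<beta> u) - \<beta> / 2 * (norm (ymax \<beta> u - ydot))\<^sup>2"
  by (simp add: smoothed_def inner_diff_right inner_commute [of _ "ymax \<beta> u"])

lemma smoothed_tangent_le:
  assumes "0 < \<beta>" "\<And>y. y \<in> Q \<Longrightarrow> v \<bullet> y - hs y \<le> c"
  shows "smoothed \<beta> u + ymax \<beta> u \<bullet> (v - u) \<le> c - \<beta> / 2 * (norm (ymax \<beta> u - ydot))\<^sup>2"
  using assms(2) [OF argmax_in [OF assms(1)]] unfolding smoothed_linear_part by simp

lemma smoothed_tangent_le_smoothed:
  assumes "0 < \<beta>" "0 < \<beta>'"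
  shows "smoothed \<beta> u + ymax \<beta> u \<bullet> (v - u)
    \<le> smoothed \<beta>' v + (\<beta>' - \<beta>) / 2 * (norm (ymax \<beta> u - ydot))\<^sup>2"
  using smoothed_ge [OF assms(2) argmax_in [OF assms(1), of u], of v]
  unfolding smoothed_linear_part by (simp add: field_simps)

end

section \<open>One iteration of coordinate descent\<close>

text \<open>
  One run of the algorithm for arbitrary parameter sequences. The number \<open>hopt\<close> stands for
  \<open>h (A xs)\<close>, and its hypothesis for the Fenchel-Young inequality. The three decay conditions make the
  estimates telescope: the first keeps the total coefficient of \<open>\<parallel>y - ydot\<parallel>\<^sup>2\<close>, which arises from changing
  \<open>\<beta>\<close>, nonpositive; the other two are the contraction of \<open>\<tau>\<^sup>2 (L\<^sub>i + \<parallel>A\<^sub>i\<parallel>\<^sup>2/\<beta>)\<close> split into its two summands.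
\<close>

locale smoothed_cd = smoothed_conjugate h ydot Q hs
  for h :: "real^'m::finite \<Rightarrow> ereal" and ydot :: "real^'m" and Q hs +
  fixes blk :: "'p::finite \<Rightarrow> 'n::finite"
    and H :: "'n \<Rightarrow> real^'p^'p"
    and A :: "real^'p^'m"
    and f :: "real^'p \<Rightarrow> real"
    and gf :: "real^'p \<Rightarrow> real^'p"
    and L :: "'n \<Rightarrow> real"
    and \<alpha> :: real and x0 :: "real^'p"
    and \<tau> \<beta> :: "nat \<Rightarrow> real"
    and xs :: "real^'p" and hopt :: real
  assumes H_spd: "block_spd blk i (H i)"
    and f_convex: "convex_on UNIV f"
    and f_gradient: "GDERIV f x :> gf x"
    and L_nonneg: "0 \<le> L i"
    and f_block_smooth: "d \<in> block_space blk i \<Longrightarrow>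
          block_dual_norm blk i (H i) (block_part blk i (gf (x + d)) - block_part blk i (gf x))
            \<le> L i * block_norm (H i) d"
    and B0_pos: "0 < B_coef blk H A L (\<beta> 0) i"
    and \<tau>_0: "\<tau> 0 = 1"
    and \<tau>_pos: "0 < \<tau> k"
    and \<tau>_le_1: "\<tau> k \<le> 1"
    and \<beta>_pos: "0 < \<beta> k"
    and \<beta>_decay: "(1 - \<tau> (Suc k)) * \<beta> k \<le> \<beta> (Suc k)"
    and \<tau>_decay: "(\<tau> (Suc k))\<^sup>2 \<le> (1 - \<tau> (Suc k)) * (\<tau> k)\<^sup>2"
    and \<tau>_\<beta>_decay: "(\<tau> (Suc k))\<^sup>2 * \<beta> k \<le> (1 - \<tau> (Suc k)) * (\<tau> k)\<^sup>2 * \<beta> (Suc k)"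
    and hopt: "y \<in> Q \<Longrightarrow> (A *v xs) \<bullet> y - hs y \<le> hopt"
begin

abbreviation B :: "real \<Rightarrow> 'n \<Rightarrow> real" where
  "B \<equiv> B_coef blk H A L"

abbreviation q :: "'n \<Rightarrow> real" where
  "q \<equiv> sampling_prob blk H A L (\<beta> 0) \<alpha>"

abbreviation iter :: "(nat \<Rightarrow> 'n) \<Rightarrow> nat \<Rightarrow> (real^'p) \<times> (real^'p)" where
  "iter \<equiv> smart_cd blk H A L gf h ydot \<alpha> x0 \<tau> \<beta>"

definition smoothed_obj :: "real \<Rightarrow> real^'p \<Rightarrow> real" where
  "smoothed_obj b x = f x + smoothed b (A *v x)"

definition smoothed_grad :: "real \<Rightarrow> real^'p \<Rightarrow> real^'p" where
  "smoothed_grad b x = gf x + transpose A *v ymax b (A *v x)"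

definition block_dir :: "real \<Rightarrow> 'n \<Rightarrow> real^'p \<Rightarrow> real^'p" where
  "block_dir b i x = block_inv blk i (H i) (block_part blk i (smoothed_grad b x))"

definition cd_next :: "nat \<Rightarrow> 'n \<Rightarrow> (real^'p) \<times> (real^'p) \<Rightarrow> (real^'p) \<times> (real^'p)" where
  "cd_next k i = (\<lambda>(xb, xt).
     let xhat = (1 - \<tau> k) *\<^sub>R xb + \<tau> k *\<^sub>R xt; z = block_dir (\<beta> k) i xhat
     in (xhat - (1 / B (\<beta> k) i) *\<^sub>R z, xt - (q i / (\<tau> k * B (\<beta> k) i)) *\<^sub>R z))"

text \<open>
  The weights are those for which the quadratic term of a block step, after multiplication by \<open>\<tau>\<^sup>2\<close>, equals
  the decrease guaranteed for the smoothed objective in the same step; at the start it is \<open>C\<^sup>*(x\<^sup>0)\<close>.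
\<close>

definition weighted_dist :: "real \<Rightarrow> real^'p \<Rightarrow> real" where
  "weighted_dist b x = (\<Sum>i\<in>UNIV. B b i / (2 * (q i)\<^sup>2) *
     (block_norm (H i) (block_part blk i xs - block_part blk i x))\<^sup>2)"

definition fopt :: real where
  "fopt = f xs + hopt"

lemma B_pos: "0 < b \<Longrightarrow> 0 < B b i"
proof -
  assume b: "0 < b"
  have "L i \<noteq> 0 \<or> block_onorm blk i (H i) A \<noteq> 0"
    using B0_pos [of i] by (auto simp: B_coef_def)
  then show ?thesis
    using b L_nonneg [of i] by (auto simp: B_coef_def add_pos_nonneg add_nonneg_pos)
qed

lemma q_pos: "0 < q i"
  using B0_pos by (auto simp: sampling_prob_def less_imp_neq [symmetric] intro!: divide_pos_pos sum_pos)

lemma sum_q: "(\<Sum>i\<in>UNIV. q i) = 1"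
proof -
  have "0 < (\<Sum>i\<in>UNIV. B (\<beta> 0) i powr \<alpha>)"
    using B0_pos by (auto simp: less_imp_neq [symmetric] intro!: sum_pos)
  then show ?thesis by (simp add: sampling_prob_def sum_divide_distrib [symmetric])
qed

lemma block_dir_in_space: "block_dir b i x \<in> block_space blk i"
  unfolding block_dir_def by (rule block_inv_in_space [OF H_spd block_part_in_space])

text \<open>
  The factor \<open>\<tau>/q\<close> in the update of \<open>xbar\<close> cancels the factor \<open>q/\<tau>\<close> in the update of \<open>xtil\<close>, so
  \<open>xbar\<close> makes a plain gradient step from \<open>xhat\<close>.
\<close>

lemma iter_Suc: "iter ix (Suc k) = cd_next k (ix k) (iter ix k)"
proof -
  obtain xb xt where it: "iter ix k = (xb, xt)" by fastforce
  define i where "i = ix k"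
  define xhat where "xhat = (1 - \<tau> k) *\<^sub>R xb + \<tau> k *\<^sub>R xt"
  define z where "z = block_dir (\<beta> k) i xhat"
  have z: "z $ j = 0" if "blk j \<noteq> i" for j
    using block_dir_in_space [of "\<beta> k" i xhat] that by (simp add: z_def block_space_def)
  have "(\<chi> j. xhat $ j + \<tau> k / q (blk j) *
        ((xt - (q i / (\<tau> k * B (\<beta> k) i)) *\<^sub>R z) $ j - xt $ j))
      = xhat - (1 / B (\<beta> k) i) *\<^sub>R z"
  proof (subst vec_eq_iff, rule allI)
    fix j
    show "(\<chi> j. xhat $ j + \<tau> k / q (blk j) *
        ((xt - (q i / (\<tau> k * B (\<beta> k) i)) *\<^sub>R z) $ j - xt $ j)) $ j
      = (xhat - (1 / B (\<beta> k) i) *\<^sub>R z) $ j"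
      using z [of j] \<tau>_pos [of k] q_pos [of i] B_pos [OF \<beta>_pos, of k i]
      by (cases "blk j = i") auto
  qed
  moreover have "iter ix (Suc k) =
    (\<chi> j. xhat $ j + \<tau> k / q (blk j) *
        ((xt - (q i / (\<tau> k * B (\<beta> k) i)) *\<^sub>R z) $ j - xt $ j),
     xt - (q i / (\<tau> k * B (\<beta> k) i)) *\<^sub>R z)"
    by (simp only: smart_cd.simps it Let_def prod.case block_part_add [symmetric]
        z_def block_dir_def smoothed_grad_def xhat_def i_def)
  ultimately show ?thesis
    by (simp only: cd_next_def it prod.case Let_def xhat_def [symmetric] i_def [symmetric] z_def)
qed

text \<open>
  Adding the descent inequalities of \<open>f\<close> and of the smoothed function gives a quadratic upper model with
  constant \<open>B b i\<close> along the block; \<open>- (1/B b i) *\<^sub>R block_dir b i x\<close> minimizes it.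
\<close>

lemma smoothed_obj_block_step:
  assumes b: "0 < b"
  shows "smoothed_obj b (x - (1 / B b i) *\<^sub>R block_dir b i x)
    \<le> smoothed_obj b x - (block_dir b i x \<bullet> smoothed_grad b x) / (2 * B b i)"
proof -
  define z where "z = block_dir b i x"
  define d where "d = - (1 / B b i) *\<^sub>R z"
  let ?o = "block_onorm blk i (H i) A" and ?G = "smoothed_grad b x"
  have z: "z \<in> block_space blk i" unfolding z_def by (rule block_dir_in_space)
  then have d: "d \<in> block_space blk i"
    unfolding d_def by (rule subspace_scale [OF subspace_block_space])
  have Bp: "0 < B b i" by (rule B_pos [OF b])
  have Hz: "H i *v z = block_part blk i ?G"
    unfolding z_def block_dir_def by (rule block_matrix_inv [OF H_spd block_part_in_space])
  have nd: "(block_norm (H i) d)\<^sup>2 = (z \<bullet> ?G) / (B b i)\<^sup>2"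
    unfolding block_norm_sq [OF H_spd d] unfolding d_def matrix_vector_mult_scaleR Hz
    by (simp add: block_part_inner_space [OF z] inner_block_part_space [OF z] inner_commute power2_eq_square)
  have f: "f (x + d) \<le> f x + gf x \<bullet> d + L i / 2 * (block_norm (H i) d)\<^sup>2"
    by (rule block_descent [OF H_spd f_gradient f_block_smooth d])
  have "smoothed b (A *v (x + d))
      \<le> smoothed b (A *v x) + ymax b (A *v x) \<bullet> (A *v d) + (norm (A *v d))\<^sup>2 / (2 * b)"
    unfolding matrix_vector_right_distrib by (rule smoothed_descent [OF b])
  moreover have "(norm (A *v d))\<^sup>2 / (2 * b) \<le> ?o\<^sup>2 / b / 2 * (block_norm (H i) d)\<^sup>2"
  proof -
    have "(norm (A *v d))\<^sup>2 \<le> (?o * block_norm (H i) d)\<^sup>2"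
      by (intro power_mono norm_mult_le_block_onorm [OF H_spd d]) simp
    then show ?thesis using b by (simp add: field_simps)
  qed
  moreover have "ymax b (A *v x) \<bullet> (A *v d) = (transpose A *v ymax b (A *v x)) \<bullet> d"
    by (simp add: dot_lmul_matrix)
  ultimately have "smoothed_obj b (x + d)
      \<le> smoothed_obj b x + ?G \<bullet> d + B b i / 2 * (block_norm (H i) d)\<^sup>2"
    using f by (simp add: smoothed_obj_def smoothed_grad_def B_coef_def inner_add_left algebra_simps
        add_divide_distrib)
  also have "\<dots> = smoothed_obj b x - (z \<bullet> ?G) / (2 * B b i)"
  proof -
    have "?G \<bullet> d = - (z \<bullet> ?G) / B b i" by (simp add: d_def inner_commute [of ?G])
    moreover have "B b i / 2 * (block_norm (H i) d)\<^sup>2 = (z \<bullet> ?G) / (2 * B b i)"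
      unfolding nd using Bp by (simp add: power2_eq_square)
    moreover have "- r / B b i + r / (2 * B b i) = - r / (2 * B b i)" for r
      using Bp by (simp add: field_simps)
    ultimately show ?thesis by simp
  qed
  finally show ?thesis by (simp add: d_def z_def)
qed

text \<open>
  Only block \<open>i\<close> of the distance changes. The last summand is the decrease guaranteed by
  \<open>smoothed_obj_block_step\<close>, so it disappears when the two lemmas are added.
\<close>

lemma weighted_dist_block_step:
  assumes b: "0 < b" and t: "0 < t"
  shows "t\<^sup>2 * weighted_dist b (x - (q i / (t * B b i)) *\<^sub>R block_dir b i y)
    = t\<^sup>2 * weighted_dist b x
      - t / q i * (block_part blk i (smoothed_grad b y) \<bullet> block_part blk i (x - xs))
      + (block_dir b i y \<bullet> smoothed_grad b y) / (2 * B b i)"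
proof -
  define z where "z = block_dir b i y"
  define s where "s = q i / (t * B b i)"
  let ?G = "smoothed_grad b y"
  let ?e = "\<lambda>l. block_part blk l xs - block_part blk l x"
  let ?c = "\<lambda>l. B b l / (2 * (q l)\<^sup>2)"
  have z: "z \<in> block_space blk i" unfolding z_def by (rule block_dir_in_space)
  have Hz: "H i *v z = block_part blk i ?G"
    unfolding z_def block_dir_def by (rule block_matrix_inv [OF H_spd block_part_in_space])
  have Bp: "0 < B b i" by (rule B_pos [OF b])
  have e: "?e i \<in> block_space blk i"
    by (simp add: subspace_diff subspace_block_space block_part_in_space)
  have upd: "block_part blk l xs - block_part blk l (x - s *\<^sub>R z)
      = (if l = i then ?e i - (- s) *\<^sub>R z else ?e l)" for l
    using z by (auto simp: block_part_diff block_part_id [of "s *\<^sub>R z"] block_part_other [of "s *\<^sub>R z" _ i]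
          subspace_scale [OF subspace_block_space])
  have "weighted_dist b (x - s *\<^sub>R z) - weighted_dist b x
    = (\<Sum>l\<in>UNIV. if l = i then ?c i * ((block_norm (H i) (?e i - (- s) *\<^sub>R z))\<^sup>2
                       - (block_norm (H i) (?e i))\<^sup>2) else 0)"
    unfolding weighted_dist_def upd sum_subtractf [symmetric]
    by (intro sum.cong) (auto simp: right_diff_distrib)
  also have "\<dots> = ?c i * (2 * s * (block_part blk i ?G \<bullet> ?e i) + s\<^sup>2 * (z \<bullet> ?G))"
    by (simp add: block_norm_diff_scaled [OF H_spd e z, of "- s", simplified] Hz
        inner_block_part_space [OF z] block_part_inner_space [OF z] inner_commute)
  finally have step: "weighted_dist b (x - s *\<^sub>R z) - weighted_dist b x
      = ?c i * (2 * s * (block_part blk i ?G \<bullet> ?e i) + s\<^sup>2 * (z \<bullet> ?G))" .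
  have eq: "t\<^sup>2 * weighted_dist b (x - s *\<^sub>R z) = t\<^sup>2 * weighted_dist b x
      + t\<^sup>2 * (?c i * (2 * s * (block_part blk i ?G \<bullet> ?e i) + s\<^sup>2 * (z \<bullet> ?G)))"
    unfolding step [symmetric] by (simp only: right_diff_distrib add_diff_cancel_left' diff_add_cancel add_diff_eq)
  have "t\<^sup>2 * (?c i * (2 * s * p + s\<^sup>2 * r)) = t / q i * p + r / (2 * B b i)" for p r
    using t Bp q_pos [of i] by (simp add: s_def power2_eq_square distrib_left)
  note eq [unfolded this]
  moreover have "block_part blk i ?G \<bullet> ?e i = - (block_part blk i ?G \<bullet> block_part blk i (x - xs))"
    by (simp add: block_part_diff inner_diff_right)
  ultimately show ?thesis by (simp add: s_def z_def)
qed

text \<open>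
  The average over the drawn block. The probability \<open>q i\<close> removes the factor \<open>1/q i\<close> of the linear
  term, and the inner products of the blocks add up to \<open>G \<bullet> (xt - xs)\<close>. Since
  \<open>t xt = xhat - (1 - t) xb\<close>, what remains is the mixture, with weights \<open>t\<close> and \<open>1 - t\<close>, of the
  tangent of the smoothed objective at \<open>xhat\<close> evaluated at \<open>xs\<close> and at \<open>xb\<close>. The parameter
  \<open>b'\<close> is the smoothing parameter of the preceding iteration.
\<close>

lemma expected_step:
  fixes xb xt :: "real^'p"
  assumes b: "0 < b" and b': "0 < b'" and t: "0 < t" "t \<le> 1" and bb: "(1 - t) * b' \<le> b"
  defines "xhat \<equiv> (1 - t) *\<^sub>R xb + t *\<^sub>R xt"
  shows "(\<Sum>i\<in>UNIV. q i *
      (smoothed_obj b (xhat - (1 / B b i) *\<^sub>R block_dir b i xhat) - fopt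
        + t\<^sup>2 * weighted_dist b (xt - (q i / (t * B b i)) *\<^sub>R block_dir b i xhat)))
    \<le> (1 - t) * (smoothed_obj b' xb - fopt) + t\<^sup>2 * weighted_dist b xt"
proof -
  let ?G = "smoothed_grad b xhat" and ?y = "ymax b (A *v xhat)"
  let ?r = "smoothed_obj b xhat - fopt + t\<^sup>2 * weighted_dist b xt"
  define N where "N = (norm (?y - ydot))\<^sup>2"
  have "(\<Sum>i\<in>UNIV. q i *
      (smoothed_obj b (xhat - (1 / B b i) *\<^sub>R block_dir b i xhat) - fopt
        + t\<^sup>2 * weighted_dist b (xt - (q i / (t * B b i)) *\<^sub>R block_dir b i xhat)))
    \<le> (\<Sum>i\<in>UNIV. q i * (?r - t / q i * (block_part blk i ?G \<bullet> block_part blk i (xt - xs))))"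
    using smoothed_obj_block_step [OF b, of xhat] less_imp_le [OF q_pos]
    unfolding weighted_dist_block_step [OF b t(1)]
    by (intro sum_mono mult_left_mono) (auto simp: algebra_simps)
  also have "\<dots> = (\<Sum>i\<in>UNIV. q i * ?r - t * (block_part blk i ?G \<bullet> block_part blk i (xt - xs)))"
    using q_pos by (intro sum.cong refl) (simp add: right_diff_distrib less_imp_neq [symmetric])
  also have "\<dots> = ?r - t * (?G \<bullet> (xt - xs))"
    unfolding sum_subtractf sum_distrib_right [of q UNIV, symmetric] sum_q
      sum_distrib_left [of t _ UNIV, symmetric] sum_block_inner by simp
  also have "t * (?G \<bullet> (xt - xs)) = - t * (?G \<bullet> (xs - xhat)) - (1 - t) * (?G \<bullet> (xb - xhat))"
    by (simp add: xhat_def inner_diff_right inner_add_right algebra_simps)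
  also have "?r - \<dots> = t * (smoothed_obj b xhat + ?G \<bullet> (xs - xhat))
      + (1 - t) * (smoothed_obj b xhat + ?G \<bullet> (xb - xhat)) - fopt + t\<^sup>2 * weighted_dist b xt"
    by (simp add: algebra_simps)
  also have "\<dots> \<le> t * (fopt - b / 2 * N) + (1 - t) * (smoothed_obj b' xb + (b' - b) / 2 * N)
      - fopt + t\<^sup>2 * weighted_dist b xt"
  proof -
    have lin: "smoothed_obj b xhat + ?G \<bullet> (x - xhat) \<le>
        f x + (smoothed b (A *v xhat) + ?y \<bullet> (A *v x - A *v xhat))" for x
    proof -
      have "?G \<bullet> (x - xhat) = gf xhat \<bullet> (x - xhat) + ?y \<bullet> (A *v x - A *v xhat)"
        by (simp add: smoothed_grad_def inner_add_left dot_lmul_matrix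
            matrix_vector_mult_diff_distrib [symmetric])
      then show ?thesis
        using convex_gradient_lower_bound [OF f_convex f_gradient, of xhat x]
        by (simp add: smoothed_obj_def)
    qed
    have 1: "smoothed_obj b xhat + ?G \<bullet> (xs - xhat) \<le> fopt - b / 2 * N"
      using lin [of xs] smoothed_tangent_le [OF b hopt, of "A *v xhat"]
      by (simp add: fopt_def N_def)
    have 2: "smoothed_obj b xhat + ?G \<bullet> (xb - xhat) \<le> smoothed_obj b' xb + (b' - b) / 2 * N"
      using lin [of xb] smoothed_tangent_le_smoothed [OF b b', of "A *v xhat" "A *v xb"]
      by (simp add: smoothed_obj_def N_def)
    show ?thesis
      using add_mono [OF mult_left_mono [OF 1, of t] mult_left_mono [OF 2, of "1 - t"]] t
      by (simp only: add_right_mono diff_right_mono less_imp_le diff_ge_0_iff_ge)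
  qed
  also have "\<dots> = (1 - t) * (smoothed_obj b' xb - fopt) + t\<^sup>2 * weighted_dist b xt
      + ((1 - t) * b' - b) * N / 2"
    by (simp add: algebra_simps add_divide_distrib diff_divide_distrib)
  also have "\<dots> \<le> (1 - t) * (smoothed_obj b' xb - fopt) + t\<^sup>2 * weighted_dist b xt"
    using bb by (simp add: N_def mult_nonpos_nonneg)
  finally show ?thesis .
qed

lemma weighted_dist_decay:
  "(\<tau> (Suc k))\<^sup>2 * weighted_dist (\<beta> (Suc k)) x \<le> (1 - \<tau> (Suc k)) * ((\<tau> k)\<^sup>2 * weighted_dist (\<beta> k) x)"
proof -
  define X where "X = (1 - \<tau> (Suc k)) * (\<tau> k)\<^sup>2"
  have "(\<tau> (Suc k))\<^sup>2 * B (\<beta> (Suc k)) i \<le> X * B (\<beta> k) i" for i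
  proof -
    have "(\<tau> (Suc k))\<^sup>2 / \<beta> (Suc k) \<le> X / \<beta> k"
      using \<tau>_\<beta>_decay [of k] \<beta>_pos [of k] \<beta>_pos [of "Suc k"]
      by (simp add: X_def pos_divide_le_eq pos_le_divide_eq mult_ac)
    from mult_left_mono [OF this, of "(block_onorm blk i (H i) A)\<^sup>2"]
      mult_left_mono [OF \<tau>_decay L_nonneg, of i k, folded X_def]
    show ?thesis by (simp add: B_coef_def algebra_simps)
  qed
  note le = this
  define w where "w i = (block_norm (H i) (block_part blk i xs - block_part blk i x))\<^sup>2 / (2 * (q i)\<^sup>2)"
    for i
  have W: "c * weighted_dist b x = (\<Sum>i\<in>UNIV. c * B b i * w i)" for b c
    by (simp add: weighted_dist_def w_def sum_distrib_left mult.assoc)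
  have "(\<Sum>i\<in>UNIV. (\<tau> (Suc k))\<^sup>2 * B (\<beta> (Suc k)) i * w i) \<le> (\<Sum>i\<in>UNIV. X * B (\<beta> k) i * w i)"
    by (intro sum_mono mult_right_mono le) (simp add: w_def)
  then have "(\<tau> (Suc k))\<^sup>2 * weighted_dist (\<beta> (Suc k)) x \<le> X * weighted_dist (\<beta> k) x"
    unfolding W .
  then show ?thesis by (simp only: X_def mult.assoc)
qed

lemma weighted_dist_nonneg: "0 < b \<Longrightarrow> 0 \<le> weighted_dist b x"
  unfolding weighted_dist_def using B_pos [of b] by (intro sum_nonneg) (simp add: less_imp_le)

lemma weighted_dist_C_star: "weighted_dist (\<beta> 0) x0 = C_star blk H A L (\<beta> 0) \<alpha> xs x0"
  by (simp add: weighted_dist_def C_star_def)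

lemma iter_cong: "(\<And>j. j < k \<Longrightarrow> ix j = ix' j) \<Longrightarrow> iter ix k = iter ix' k"
  by (induction k) (simp_all add: Let_def)

end

section \<open>Expectations over independent draws\<close>

context prob_space
begin

lemma measurable_finite_history:
  fixes I :: "nat \<Rightarrow> 'a \<Rightarrow> 'n::finite"
  assumes rv: "\<And>j. I j \<in> measurable M (count_space UNIV)"
  shows "(\<lambda>\<omega>. restrict (\<lambda>j. I j \<omega>) {..<k}) \<in> measurable M (count_space ({..<k} \<rightarrow>\<^sub>E UNIV))"
proof -
  have "(\<lambda>\<omega>. restrict (\<lambda>j. I j \<omega>) {..<k}) \<in> measurable M (PiM {..<k} (\<lambda>_. count_space UNIV))"
    using rv by (intro measurable_restrict)
  then show ?thesis
    by (subst (asm) count_space_PiM_finite) (auto intro: countable_finite)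
qed

text \<open>
  A function of finitely many draws from a finite set takes finitely many values.
\<close>

lemma integrable_finite_history:
  fixes I :: "nat \<Rightarrow> 'a \<Rightarrow> 'n::finite" and \<Psi> :: "(nat \<Rightarrow> 'n) \<Rightarrow> real"
  assumes rv: "\<And>j. I j \<in> measurable M (count_space UNIV)"
    and dep: "\<And>s s'. (\<And>j. j < k \<Longrightarrow> s j = s' j) \<Longrightarrow> \<Psi> s = \<Psi> s'"
  shows "integrable M (\<lambda>\<omega>. \<Psi> (\<lambda>j. I j \<omega>))"
proof -
  let ?E = "{..<k} \<rightarrow>\<^sub>E (UNIV :: 'n set)" and ?X = "\<lambda>\<omega>. restrict (\<lambda>j. I j \<omega>) {..<k}"
  have eq: "\<Psi> (\<lambda>j. I j \<omega>) = \<Psi> (?X \<omega>)" for \<omega> by (rule dep) simp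
  have fin: "finite ?E" by (intro finite_PiE) auto
  have "integrable M (\<lambda>\<omega>. \<Psi> (?X \<omega>))"
  proof (rule integrable_const_bound)
    show "AE \<omega> in M. norm (\<Psi> (?X \<omega>)) \<le> Max ((\<lambda>s. \<bar>\<Psi> s\<bar>) ` ?E)"
      using fin by (intro AE_I2) (auto intro!: Max_ge)
    show "(\<lambda>\<omega>. \<Psi> (?X \<omega>)) \<in> borel_measurable M"
      by (rule measurable_compose [OF measurable_finite_history [OF rv]]) auto
  qed
  then show ?thesis by (simp add: eq)
qed

text \<open>
  This replaces conditioning on the first \<open>k\<close> draws: splitting according to the value of draw \<open>k\<close>, every
  summand is a product of a function of the earlier draws and an indicator independent of them.
\<close>

lemma expectation_next_draw:
  fixes I :: "nat \<Rightarrow> 'a \<Rightarrow> 'n::finite" and \<Phi> :: "(nat \<Rightarrow> 'n) \<Rightarrow> 'n \<Rightarrow> real"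
  assumes indep: "indep_vars (\<lambda>_. count_space UNIV) I UNIV"
    and distr: "\<And>i. prob {\<omega> \<in> space M. I k \<omega> = i} = q i"
    and dep: "\<And>s s'. (\<And>j. j < k \<Longrightarrow> s j = s' j) \<Longrightarrow> \<Phi> s = \<Phi> s'"
  shows "expectation (\<lambda>\<omega>. \<Phi> (\<lambda>j. I j \<omega>) (I k \<omega>))
    = expectation (\<lambda>\<omega>. \<Sum>i\<in>UNIV. q i * \<Phi> (\<lambda>j. I j \<omega>) i)"
proof -
  have rv: "I j \<in> measurable M (count_space UNIV)" for j
    using indep by (simp add: indep_vars_def)
  let ?X = "\<lambda>\<omega>. restrict (\<lambda>j. I j \<omega>) {..<k}"
  let ?ind = "\<lambda>i \<omega>. indicat_real {i} (I k \<omega>)"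
  have eq: "\<Phi> (\<lambda>j. I j \<omega>) = \<Phi> (?X \<omega>)" for \<omega> by (rule dep) simp
  have int: "integrable M (\<lambda>\<omega>. \<Phi> (\<lambda>j. I j \<omega>) i)" for i
    by (rule integrable_finite_history [OF rv, of k], rule fun_cong [OF dep])
  have int': "integrable M (\<lambda>\<omega>. \<Phi> (\<lambda>j. I j \<omega>) i * ?ind i \<omega>)" for i
    by (rule integrable_finite_history [OF rv, of "Suc k" "\<lambda>s. \<Phi> s i * indicat_real {i} (s k)"])
       (rule arg_cong2 [where f = times, OF fun_cong [OF dep]], simp_all)
  have int_ind: "integrable M (?ind i)" for i
    by (rule integrable_finite_history [OF rv, of "Suc k" "\<lambda>s. indicat_real {i} (s k)"]) simp
  have ex_ind: "expectation (?ind i) = q i" for i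
  proof -
    have "expectation (?ind i) = expectation (indicat_real {\<omega> \<in> space M. I k \<omega> = i})"
      by (intro Bochner_Integration.integral_cong) (auto simp: indicator_def)
    also have "\<dots> = q i" using distr [of i] by (simp add: Int_absorb2)
    finally show ?thesis .
  qed
  have step: "expectation (\<lambda>\<omega>. \<Phi> (\<lambda>j. I j \<omega>) i * ?ind i \<omega>)
      = q i * expectation (\<lambda>\<omega>. \<Phi> (\<lambda>j. I j \<omega>) i)" for i
  proof -
    have "indep_var borel ((\<lambda>s. \<Phi> s i) \<circ> ?X)
        borel ((\<lambda>s. indicat_real {i} (s k)) \<circ> (\<lambda>\<omega>. restrict (\<lambda>j. I j \<omega>) {k}))"
    proof (rule indep_var_compose [OF indep_var_restrict [OF indep]])
      show "(\<lambda>s. \<Phi> s i) \<in> borel_measurable (PiM {..<k} (\<lambda>_. count_space UNIV))"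
        by (subst count_space_PiM_finite) (auto intro: countable_finite)
      show "(\<lambda>s. indicat_real {i} (s k)) \<in> borel_measurable (PiM {k} (\<lambda>_. count_space UNIV))"
        by (subst count_space_PiM_finite) (auto intro: countable_finite)
    qed auto
    then have "indep_var borel (\<lambda>\<omega>. \<Phi> (\<lambda>j. I j \<omega>) i) borel (?ind i)"
      by (simp add: o_def eq)
    from indep_var_lebesgue_integral [OF this int int_ind] show ?thesis
      by (simp add: ex_ind)
  qed
  have "expectation (\<lambda>\<omega>. \<Phi> (\<lambda>j. I j \<omega>) (I k \<omega>))
      = expectation (\<lambda>\<omega>. \<Sum>i\<in>UNIV. \<Phi> (\<lambda>j. I j \<omega>) i * ?ind i \<omega>)"
    by (intro Bochner_Integration.integral_cong refl) (simp add: indicator_def if_distrib [of "(*) _"] cong: if_cong)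
  also have "\<dots> = (\<Sum>i\<in>UNIV. expectation (\<lambda>\<omega>. \<Phi> (\<lambda>j. I j \<omega>) i * ?ind i \<omega>))"
    by (rule Bochner_Integration.integral_sum) (rule int')
  also have "\<dots> = expectation (\<lambda>\<omega>. \<Sum>i\<in>UNIV. q i * \<Phi> (\<lambda>j. I j \<omega>) i)"
    using int by (simp add: step Bochner_Integration.integral_sum)
  finally show ?thesis .
qed

end

section \<open>Expected progress over the whole run\<close>

locale randomized_smoothed_cd =
  smoothed_cd h ydot Q hs blk H A f gf L \<alpha> x0 \<tau> \<beta> xs hopt + prob_space M
  for h :: "real^'m::finite \<Rightarrow> ereal" and ydot Q hs
    and blk :: "'p::finite \<Rightarrow> 'n::finite" and H A f gf L \<alpha> x0 \<tau> \<beta> xs hopt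
    and M :: "'a measure" +
  fixes I :: "nat \<Rightarrow> 'a \<Rightarrow> 'n"
  assumes draws_indep: "indep_vars (\<lambda>_. count_space UNIV) I UNIV"
    and draws_distr: "prob {\<omega> \<in> space M. I k \<omega> = i} = sampling_prob blk H A L (\<beta> 0) \<alpha> i"
begin

definition lyapunov :: "nat \<Rightarrow> (real^'p) \<times> (real^'p) \<Rightarrow> real" where
  "lyapunov k p = smoothed_obj (\<beta> k) (fst p) - fopt + (\<tau> k)\<^sup>2 * weighted_dist (\<beta> k) (snd p)"

lemma integrable_iter: "integrable M (\<lambda>\<omega>. \<Psi> (iter (\<lambda>j. I j \<omega>) k) :: real)"
proof (rule integrable_finite_history [where \<Psi> = "\<lambda>s. \<Psi> (iter s k)" and k = k])
  show "I j \<in> measurable M (count_space UNIV)" for j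
    using draws_indep by (simp add: indep_vars_def)
  show "\<Psi> (iter s k) = \<Psi> (iter s' k)" if "\<And>j. j < k \<Longrightarrow> s j = s' j" for s s'
    using iter_cong [OF that] by simp
qed

lemma expectation_lyapunov_step:
  "expectation (\<lambda>\<omega>. lyapunov k (iter (\<lambda>j. I j \<omega>) (Suc k)))
    = expectation (\<lambda>\<omega>. \<Sum>i\<in>UNIV. q i * lyapunov k (cd_next k i (iter (\<lambda>j. I j \<omega>) k)))"
proof -
  have dep: "(\<lambda>i. lyapunov k (cd_next k i (iter s k))) = (\<lambda>i. lyapunov k (cd_next k i (iter s' k)))"
    if "\<And>j. j < k \<Longrightarrow> s j = s' j" for s s'
    using iter_cong [OF that] by simp
  show ?thesis
    unfolding iter_Suc by (rule expectation_next_draw [OF draws_indep draws_distr dep])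
qed

lemma lyapunov_one_step:
  assumes "0 < b'" "(1 - \<tau> k) * b' \<le> \<beta> k"
  shows "(\<Sum>i\<in>UNIV. q i * lyapunov k (cd_next k i p))
    \<le> (1 - \<tau> k) * (smoothed_obj b' (fst p) - fopt) + (\<tau> k)\<^sup>2 * weighted_dist (\<beta> k) (snd p)"
  using expected_step [OF \<beta>_pos assms(1) \<tau>_pos \<tau>_le_1 assms(2), of "fst p" "snd p"]
  by (simp add: lyapunov_def cd_next_def Let_def case_prod_beta)

text \<open>
  Since \<open>\<tau> 0 = 1\<close>, the first iteration forgets the initial gap, and only the weighted distance of \<open>x0\<close>
  remains.
\<close>

lemma expectation_lyapunov:
  "expectation (\<lambda>\<omega>. lyapunov k (iter (\<lambda>j. I j \<omega>) (Suc k)))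
    \<le> (\<Prod>j=1..k. 1 - \<tau> j) * C_star blk H A L (\<beta> 0) \<alpha> xs x0"
proof (induction k)
  case 0
  have "expectation (\<lambda>\<omega>. lyapunov 0 (iter (\<lambda>j. I j \<omega>) (Suc 0)))
      = (\<Sum>i\<in>UNIV. q i * lyapunov 0 (cd_next 0 i (x0, x0)))"
    unfolding expectation_lyapunov_step by (simp add: prob_space)
  also have "\<dots> \<le> C_star blk H A L (\<beta> 0) \<alpha> xs x0"
    using lyapunov_one_step [of "\<beta> 0" 0 "(x0, x0)"] \<beta>_pos [of 0]
    by (simp add: \<tau>_0 weighted_dist_C_star)
  finally show ?case by simp
next
  case (Suc k)
  let ?it = "\<lambda>\<omega>. iter (\<lambda>j. I j \<omega>) (Suc k)"
  have "expectation (\<lambda>\<omega>. lyapunov (Suc k) (iter (\<lambda>j. I j \<omega>) (Suc (Suc k))))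
      = expectation (\<lambda>\<omega>. \<Sum>i\<in>UNIV. q i * lyapunov (Suc k) (cd_next (Suc k) i (?it \<omega>)))"
    by (rule expectation_lyapunov_step)
  also have "\<dots> \<le> expectation (\<lambda>\<omega>. (1 - \<tau> (Suc k)) * lyapunov k (?it \<omega>))"
  proof (rule integral_mono)
    show "integrable M (\<lambda>\<omega>. \<Sum>i\<in>UNIV. q i * lyapunov (Suc k) (cd_next (Suc k) i (?it \<omega>)))"
      by (rule integrable_iter)
    show "integrable M (\<lambda>\<omega>. (1 - \<tau> (Suc k)) * lyapunov k (?it \<omega>))"
      by (rule integrable_iter)
    show "(\<Sum>i\<in>UNIV. q i * lyapunov (Suc k) (cd_next (Suc k) i (?it \<omega>)))
        \<le> (1 - \<tau> (Suc k)) * lyapunov k (?it \<omega>)" for \<omega>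
      using lyapunov_one_step [OF \<beta>_pos \<beta>_decay, of k "?it \<omega>"]
        weighted_dist_decay [of k "snd (?it \<omega>)"]
      by (simp only: lyapunov_def distrib_left)
  qed
  also have "\<dots> = (1 - \<tau> (Suc k)) * expectation (\<lambda>\<omega>. lyapunov k (?it \<omega>))"
    by (rule Bochner_Integration.integral_mult_right_zero)
  also have "\<dots> \<le> (1 - \<tau> (Suc k)) * ((\<Prod>j=1..k. 1 - \<tau> j) * C_star blk H A L (\<beta> 0) \<alpha> xs x0)"
    using Suc \<tau>_le_1 by (intro mult_left_mono) auto
  also have "\<dots> = (\<Prod>j=1..Suc k. 1 - \<tau> j) * C_star blk H A L (\<beta> 0) \<alpha> xs x0"
    by (simp add: mult_ac)
  finally show ?case .
qed

lemma expected_smoothed_gap: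
  "expectation (\<lambda>\<omega>. smoothed_obj (\<beta> k) (fst (iter (\<lambda>j. I j \<omega>) (Suc k))) - fopt)
    \<le> (\<Prod>j=1..k. 1 - \<tau> j) * C_star blk H A L (\<beta> 0) \<alpha> xs x0"
proof (rule order_trans [OF integral_mono expectation_lyapunov])
  show "integrable M (\<lambda>\<omega>. smoothed_obj (\<beta> k) (fst (iter (\<lambda>j. I j \<omega>) (Suc k))) - fopt)"
    by (rule integrable_iter)
  show "integrable M (\<lambda>\<omega>. lyapunov k (iter (\<lambda>j. I j \<omega>) (Suc k)))"
    by (rule integrable_iter)
qed (simp add: lyapunov_def weighted_dist_nonneg \<beta>_pos)

end

section \<open>The smoothed maximizer as a proximal point\<close>

text \<open>
  A point \<open>v\<close> at which \<open>h\<close> has value \<open>a\<close> and subgradient \<open>y0 = ydot + (u - v)/\<beta>\<close> is the proximal point of \<open>u\<close>.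
  Bounding the conjugate below by \<open>v \<bullet> y - a\<close>, with equality at \<open>y0\<close>, leaves a concave quadratic in \<open>y\<close> whose
  maximizer is \<open>y0\<close>.
\<close>

lemma smoothed_argmax_prox:
  fixes u v ydot :: "'v::real_inner"
  assumes \<beta>: "0 < \<beta>"
    and y0: "y0 = ydot + (1 / \<beta>) *\<^sub>R (u - v)"
    and conj_y0: "fenchel_conj h y0 = ereal (v \<bullet> y0 - a)"
    and conj_ge: "\<And>y. ereal (v \<bullet> y - a) \<le> fenchel_conj h y"
  shows smoothed_argmax_prox_eq: "smoothed_argmax h ydot \<beta> u = y0"
    and smoothed_argmax_prox_gap: "fenchel_conj h y < \<infinity> \<Longrightarrow>
      u \<bullet> y - real_of_ereal (fenchel_conj h y) - \<beta> / 2 * (norm (y - ydot))\<^sup>2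
        + \<beta> / 2 * (norm (y - y0))\<^sup>2
      \<le> u \<bullet> y0 - real_of_ereal (fenchel_conj h y0) - \<beta> / 2 * (norm (y0 - ydot))\<^sup>2"
proof -
  have uv: "u - v = \<beta> *\<^sub>R (y0 - ydot)" using \<beta> by (simp add: y0)
  have square: "(u - v) \<bullet> y - \<beta> / 2 * (norm (y - ydot))\<^sup>2 + \<beta> / 2 * (norm (y - y0))\<^sup>2
    = (u - v) \<bullet> y0 - \<beta> / 2 * (norm (y0 - ydot))\<^sup>2" for y
    unfolding uv
    by (simp add: power2_norm_eq_inner inner_diff_left inner_diff_right inner_commute field_simps)
  have gap: "u \<bullet> y - r - \<beta> / 2 * (norm (y - ydot))\<^sup>2 + \<beta> / 2 * (norm (y - y0))\<^sup>2
      \<le> u \<bullet> y0 - (v \<bullet> y0 - a) - \<beta> / 2 * (norm (y0 - ydot))\<^sup>2"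
    if "fenchel_conj h y = ereal r" for y r
  proof -
    have "v \<bullet> y - a \<le> r" using conj_ge [of y] that by simp
    then show ?thesis using square [of y] by (simp add: inner_diff_left)
  qed
  have not_minus: "fenchel_conj h y \<noteq> - \<infinity>" for y using conj_ge [of y] by auto
  let ?G = "\<lambda>y. ereal (u \<bullet> y) - fenchel_conj h y - ereal (\<beta> / 2 * (norm (y - ydot))\<^sup>2)"
  show "smoothed_argmax h ydot \<beta> u = y0"
    unfolding smoothed_argmax_def
  proof (rule the_equality)
    show "is_arg_max ?G (\<lambda>_. True) y0"
      unfolding is_arg_max_def
    proof (intro conjI notI TrueI)
      assume "\<exists>y. True \<and> ?G y0 < ?G y"
      then obtain y where y: "?G y0 < ?G y" by blast
      show False
      proof (cases "fenchel_conj h y")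
        case (real r)
        have "0 \<le> \<beta> / 2 * (norm (y - y0))\<^sup>2" using \<beta> by simp
        then show False using y gap [OF real] by (simp add: real conj_y0)
      qed (use y not_minus [of y] in auto)
    qed
    fix y assume "is_arg_max ?G (\<lambda>_. True) y"
    then have y: "\<not> ?G y < ?G y0" by (auto simp: is_arg_max_def)
    show "y = y0"
    proof (cases "fenchel_conj h y")
      case (real r)
      have "\<beta> / 2 * (norm (y - y0))\<^sup>2 \<le> 0" using y gap [OF real] by (simp add: real conj_y0)
      then have "(norm (y - y0))\<^sup>2 \<le> 0" using \<beta> by (simp add: mult_le_0_iff)
      then show ?thesis by simp
    qed (use y not_minus [of y] in \<open>auto simp: conj_y0\<close>)
  qed
  show "u \<bullet> y - real_of_ereal (fenchel_conj h y) - \<beta> / 2 * (norm (y - ydot))\<^sup>2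
        + \<beta> / 2 * (norm (y - y0))\<^sup>2
      \<le> u \<bullet> y0 - real_of_ereal (fenchel_conj h y0) - \<beta> / 2 * (norm (y0 - ydot))\<^sup>2"
    if "fenchel_conj h y < \<infinity>"
    using that not_minus [of y] gap [of y] conj_y0 by (cases "fenchel_conj h y") auto
qed

section \<open>Lipschitz functions\<close>

lemma fenchel_conj_ge: "ereal (u \<bullet> y - h u) \<le> fenchel_conj (\<lambda>u. ereal (h u)) y"
  unfolding fenchel_conj_def by (rule SUP_upper2 [of u]) auto

lemma fenchel_conj_subgradient:
  assumes "\<And>w. h v + y \<bullet> (w - v) \<le> h w"
  shows "fenchel_conj (\<lambda>u. ereal (h u)) y = ereal (v \<bullet> y - h v)"
proof (rule antisym [OF _ fenchel_conj_ge])
  show "fenchel_conj (\<lambda>u. ereal (h u)) y \<le> ereal (v \<bullet> y - h v)"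
    unfolding fenchel_conj_def
  proof (rule SUP_least)
    fix w show "ereal (w \<bullet> y) - ereal (h w) \<le> ereal (v \<bullet> y - h v)"
      using assms [of w] by (simp add: inner_diff_right inner_commute)
  qed
qed

text \<open>
  The point \<open>v\<close> minimizes \<open>h v + (u - v) \<bullet> ydot + \<parallel>u - v\<parallel>\<^sup>2/(2\<beta>)\<close>. A minimizer exists because the Lipschitz
  bound keeps the function at or above its value at \<open>u\<close> outside a ball, and the subgradient inequality is its
  optimality condition: move from \<open>v\<close> a fraction \<open>t\<close> towards \<open>w\<close> and let \<open>t\<close> tend to \<open>0\<close>.
\<close>

lemma prox_subgradient_exists:
  fixes h :: "'v::euclidean_space \<Rightarrow> real"
  assumes convex: "convex_on UNIV h" and lip: "C-lipschitz_on UNIV h" and \<beta>: "0 < \<beta>"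
  shows "\<exists>v. \<forall>w. h v + (ydot + (1 / \<beta>) *\<^sub>R (u - v)) \<bullet> (w - v) \<le> h w"
proof -
  define \<phi> where "\<phi> v = h v + (u - v) \<bullet> ydot + (norm (u - v))\<^sup>2 / (2 * \<beta>)" for v
  define R where "R = 2 * \<beta> * (C + norm ydot)"
  have C: "0 \<le> C" using lip by (rule lipschitz_on_nonneg)
  have "continuous_on UNIV h" using lip by (rule lipschitz_on_continuous_on)
  then have "continuous_on (cball u R) h" by (rule continuous_on_subset) simp
  then have "continuous_on (cball u R) \<phi>"
    unfolding \<phi>_def by (intro continuous_intros) (use \<beta> in auto)
  moreover have "0 \<le> R" using C \<beta> by (simp add: R_def)
  ultimately obtain v where v: "v \<in> cball u R" "\<And>w. w \<in> cball u R \<Longrightarrow> \<phi> v \<le> \<phi> w"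
    using continuous_attains_inf [of "cball u R" \<phi>] by auto
  have min: "\<phi> v \<le> \<phi> w" for w
  proof (cases "w \<in> cball u R")
    case False
    let ?n = "norm (u - w)"
    have n: "R < ?n" using False by (simp add: dist_norm)
    then have "0 < ?n" using \<open>0 \<le> R\<close> by linarith
    have "h u - h w \<le> C * ?n"
      using lipschitz_onD [OF lip, of u w] by (simp add: dist_norm)
    moreover have "\<bar>(u - w) \<bullet> ydot\<bar> \<le> ?n * norm ydot" by (rule Cauchy_Schwarz_ineq2)
    moreover have "(C + norm ydot) * ?n \<le> ?n\<^sup>2 / (2 * \<beta>)"
    proof -
      have "(C + norm ydot) * (2 * \<beta>) \<le> ?n" using n by (simp add: R_def mult_ac)
      then have "(C + norm ydot) * (2 * \<beta>) * ?n \<le> ?n * ?n"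
        using \<open>0 < ?n\<close> by (intro mult_right_mono) auto
      then have "(C + norm ydot) * ?n * (2 * \<beta>) \<le> ?n\<^sup>2"
        by (simp only: power2_eq_square mult_ac)
      then show ?thesis using \<beta> by (simp only: pos_le_divide_eq mult_pos_pos zero_less_numeral)
    qed
    ultimately have "\<phi> u \<le> \<phi> w" by (simp add: \<phi>_def algebra_simps)
    moreover have "\<phi> v \<le> \<phi> u" using v(2) [of u] \<open>0 \<le> R\<close> by simp
    ultimately show ?thesis by simp
  qed (rule v(2))
  show ?thesis
  proof (intro exI allI)
    fix w
    define g where "g = (ydot + (1 / \<beta>) *\<^sub>R (u - v)) \<bullet> (w - v)"
    define s where "s = (norm (w - v))\<^sup>2 / (2 * \<beta>)"
    have le: "g \<le> h w - h v + t * s" if t: "0 < t" "t < 1" for t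
    proof -
      let ?w = "(1 - t) *\<^sub>R v + t *\<^sub>R w"
      have "h ?w \<le> (1 - t) * h v + t * h w"
        using convex t by (intro convex_onD) auto
      moreover have "\<phi> ?w - h ?w = \<phi> v - h v - t * g + t * (t * s)"
      proof -
        have w: "u - ?w = (u - v) - t *\<^sub>R (w - v)" by (simp add: algebra_simps)
        have expand: "(d - t *\<^sub>R e) \<bullet> ydot + (norm (d - t *\<^sub>R e))\<^sup>2 / (2 * \<beta>)
            = d \<bullet> ydot + (norm d)\<^sup>2 / (2 * \<beta>) - t * ((ydot + (1 / \<beta>) *\<^sub>R d) \<bullet> e)
              + t * (t * ((norm e)\<^sup>2 / (2 * \<beta>)))" for d e
          using \<beta> by (simp add: power2_norm_eq_inner inner_diff_left inner_diff_right
              inner_add_left inner_add_right inner_commute field_simps)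
        show ?thesis
          using expand [of "u - v" "w - v"] unfolding \<phi>_def g_def s_def w by linarith
      qed
      moreover have "\<phi> v \<le> \<phi> ?w" by (rule min)
      ultimately have "t * g \<le> t * (h w - h v + t * s)" by (simp add: algebra_simps)
      then show ?thesis using t by simp
    qed
    have "g \<le> h w - h v"
    proof (rule field_le_epsilon)
      fix e :: real assume e: "0 < e"
      have s: "0 \<le> s" using \<beta> by (simp add: s_def)
      define t where "t = min (1 / 2) (e / (s + 1))"
      have t: "0 < t" "t < 1" using e s by (auto simp: t_def)
      have "t * s \<le> e / (s + 1) * (s + 1)" using e s by (intro mult_mono) (auto simp: t_def)
      then show "g \<le> h w - h v + e" using le [OF t] s by simp
    qed
    then show "h v + (ydot + (1 / \<beta>) *\<^sub>R (u - v)) \<bullet> (w - v) \<le> h w" by (simp add: g_def)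
  qed
qed

context
  fixes h :: "'v::euclidean_space \<Rightarrow> real" and C :: real
  assumes convex: "convex_on UNIV h" and lip: "C-lipschitz_on UNIV h"
begin

abbreviation (input) lifted_h :: "'v \<Rightarrow> ereal" where "lifted_h \<equiv> \<lambda>u. ereal (h u)"

abbreviation (input) hconj :: "'v \<Rightarrow> real" where "hconj \<equiv> \<lambda>y. real_of_ereal (fenchel_conj lifted_h y)"

lemma lipschitz_le: "h u \<le> h v + C * norm (u - v)"
  using lipschitz_onD [OF lip, of u v] by (simp add: dist_norm)

lemma Fenchel_Young: "y \<in> edom (fenchel_conj lifted_h) \<Longrightarrow> u \<bullet> y - hconj y \<le> h u"
  using fenchel_conj_ge [of u y h] by (cases "fenchel_conj lifted_h y") (auto simp: edom_def)

text \<open>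
  Testing the conjugate with large multiples of \<open>y\<close> would make it infinite if \<open>norm y > C\<close>.
\<close>

lemma norm_le_on_conj_domain:
  assumes "y \<in> edom (fenchel_conj lifted_h)"
  shows "norm y \<le> C"
proof (rule ccontr)
  assume "\<not> norm y \<le> C"
  moreover have C: "0 \<le> C" using lip by (rule lipschitz_on_nonneg)
  ultimately have pos: "0 < norm y * (norm y - C)" by (intro mult_pos_pos) auto
  define t where "t = (\<bar>h 0 + hconj y\<bar> + 1) / (norm y * (norm y - C))"
  have t: "0 \<le> t" using pos by (simp add: t_def)
  have "t * (norm y * norm y) \<le> h (t *\<^sub>R y) + hconj y"
    using Fenchel_Young [OF assms, of "t *\<^sub>R y"]
    by (simp add: power2_norm_eq_inner [symmetric] power2_eq_square)
  also have "h (t *\<^sub>R y) \<le> h 0 + C * (t * norm y)"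
    using lipschitz_le [of "t *\<^sub>R y" 0] t by simp
  finally have "t * (norm y * (norm y - C)) \<le> h 0 + hconj y" by (simp add: algebra_simps)
  moreover have "t * (norm y * (norm y - C)) = \<bar>h 0 + hconj y\<bar> + 1"
    unfolding t_def by (rule nonzero_eq_divide_eq [THEN iffD1, OF _ refl]) (use pos in linarith)
  ultimately show False by linarith
qed

lemma prox_point:
  assumes "0 < \<beta>"
  obtains v where
    "smoothed_argmax lifted_h ydot \<beta> u = ydot + (1 / \<beta>) *\<^sub>R (u - v)"
    "fenchel_conj lifted_h (smoothed_argmax lifted_h ydot \<beta> u) = ereal (v \<bullet> smoothed_argmax lifted_h ydot \<beta> u - h v)"
proof -
  obtain v where v: "\<And>w. h v + (ydot + (1 / \<beta>) *\<^sub>R (u - v)) \<bullet> (w - v) \<le> h w"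
    using prox_subgradient_exists [OF convex lip assms] by blast
  note cj = fenchel_conj_subgradient [of h v, OF v]
  have "smoothed_argmax lifted_h ydot \<beta> u = ydot + (1 / \<beta>) *\<^sub>R (u - v)"
    by (rule smoothed_argmax_prox_eq [OF assms refl cj fenchel_conj_ge])
  with cj show thesis by (intro that [of v]) simp_all
qed

lemma smoothed_conjugate_lipschitz: "smoothed_conjugate lifted_h ydot (edom (fenchel_conj lifted_h)) hconj"
proof
  fix \<beta> :: real and u assume \<beta>: "0 < \<beta>"
  obtain v where v: "smoothed_argmax lifted_h ydot \<beta> u = ydot + (1 / \<beta>) *\<^sub>R (u - v)"
    "fenchel_conj lifted_h (smoothed_argmax lifted_h ydot \<beta> u) = ereal (v \<bullet> smoothed_argmax lifted_h ydot \<beta> u - h v)"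
    using prox_point [OF \<beta>] .
  show "smoothed_argmax lifted_h ydot \<beta> u \<in> edom (fenchel_conj lifted_h)"
    by (simp add: edom_def v(2))
  show "u \<bullet> y - hconj y - \<beta> / 2 * (norm (y - ydot))\<^sup>2
        + \<beta> / 2 * (norm (y - smoothed_argmax lifted_h ydot \<beta> u))\<^sup>2
      \<le> u \<bullet> smoothed_argmax lifted_h ydot \<beta> u - hconj (smoothed_argmax lifted_h ydot \<beta> u)
        - \<beta> / 2 * (norm (smoothed_argmax lifted_h ydot \<beta> u - ydot))\<^sup>2"
    if "y \<in> edom (fenchel_conj lifted_h)" for y
    by (rule smoothed_argmax_prox_gap [OF \<beta> v fenchel_conj_ge]) (use that in \<open>simp add: edom_def\<close>)
qed

lemma conj_dom_radius_lipschitz: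
  shows conj_dom_radius_finite: "conj_dom_radius lifted_h ydot < \<infinity>"
    and norm_le_conj_dom_radius:
      "y \<in> edom (fenchel_conj lifted_h) \<Longrightarrow> norm (y - ydot) \<le> real_of_ereal (conj_dom_radius lifted_h ydot)"
    and conj_dom_radius_nonneg: "0 \<le> real_of_ereal (conj_dom_radius lifted_h ydot)"
proof -
  have "conj_dom_radius lifted_h ydot \<le> ereal (C + norm ydot)"
    unfolding conj_dom_radius_def
  proof (rule SUP_least)
    fix y assume "y \<in> edom (fenchel_conj lifted_h)"
    then show "ereal (norm (y - ydot)) \<le> ereal (C + norm ydot)"
      using norm_le_on_conj_domain [of y] norm_triangle_ineq4 [of y ydot] by simp
  qed
  then show fin: "conj_dom_radius lifted_h ydot < \<infinity>" by (rule order_le_less_trans) simp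
  have le: "ereal (norm (y - ydot)) \<le> conj_dom_radius lifted_h ydot" if "y \<in> edom (fenchel_conj lifted_h)" for y
    unfolding conj_dom_radius_def by (rule SUP_upper) (rule that)
  show radius: "norm (y - ydot) \<le> real_of_ereal (conj_dom_radius lifted_h ydot)"
    if "y \<in> edom (fenchel_conj lifted_h)" for y
    using le [OF that] fin by (cases "conj_dom_radius lifted_h ydot") auto
  have "smoothed_argmax lifted_h ydot 1 0 \<in> edom (fenchel_conj lifted_h)"
    by (rule smoothed_conjugate.argmax_in [OF smoothed_conjugate_lipschitz]) simp
  from radius [OF this] show "0 \<le> real_of_ereal (conj_dom_radius lifted_h ydot)"
    by (rule order_trans [OF norm_ge_zero])
qed

text \<open>
  Biconjugation in disguise. The maximizer \<open>y\<close> for a small parameter \<open>\<epsilon>\<close> is a subgradient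
  at the proximal point \<open>v\<close>, which lies within \<open>\<epsilon> D\<close> of \<open>u\<close>. Inserting this \<open>y\<close> into the maximum defining
  the smoothed function with parameter \<open>\<beta>\<close> gives the claim up to an error of order \<open>\<epsilon>\<close>.
\<close>

lemma le_smoothed:
  assumes \<beta>: "0 < \<beta>"
  shows "h u \<le> smoothed_conjugate.smoothed lifted_h ydot hconj \<beta> u
    + \<beta> / 2 * (real_of_ereal (conj_dom_radius lifted_h ydot))\<^sup>2"
proof -
  interpret smoothed_conjugate lifted_h ydot "edom (fenchel_conj lifted_h)" hconj
    by (rule smoothed_conjugate_lipschitz)
  define D where "D = real_of_ereal (conj_dom_radius lifted_h ydot)"
  have D: "0 \<le> D" unfolding D_def by (rule conj_dom_radius_nonneg)
  have C: "0 \<le> C" using lip by (rule lipschitz_on_nonneg)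
  have approx: "h u \<le> smoothed \<beta> u + \<beta> / 2 * D\<^sup>2 + \<epsilon> * (2 * C * D)" if \<epsilon>: "0 < \<epsilon>" for \<epsilon>
  proof -
    define y where "y = smoothed_argmax lifted_h ydot \<epsilon> u"
    obtain v where v: "y = ydot + (1 / \<epsilon>) *\<^sub>R (u - v)" "fenchel_conj lifted_h y = ereal (v \<bullet> y - h v)"
      using prox_point [OF \<epsilon>, of ydot u] unfolding y_def by blast
    have yQ: "y \<in> edom (fenchel_conj lifted_h)" by (simp add: edom_def v(2))
    have yD: "norm (y - ydot) \<le> D" unfolding D_def by (rule norm_le_conj_dom_radius [OF yQ])
    have "u - v = \<epsilon> *\<^sub>R (y - ydot)" using \<epsilon> by (simp add: v(1))
    then have uv: "norm (u - v) \<le> \<epsilon> * D" using \<epsilon> yD by simp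
    have "h u \<le> h v + C * norm (u - v)" by (rule lipschitz_le)
    moreover have "h v = u \<bullet> y - hconj y - (u - v) \<bullet> y" by (simp add: v(2) inner_diff_left)
    moreover have "- ((u - v) \<bullet> y) \<le> C * norm (u - v)"
      using Cauchy_Schwarz_ineq2 [of "u - v" y]
        mult_right_mono [OF norm_le_on_conj_domain [OF yQ] norm_ge_zero [of "u - v"]]
      by (simp add: mult.commute)
    moreover have "u \<bullet> y - hconj y \<le> smoothed \<beta> u + \<beta> / 2 * (norm (y - ydot))\<^sup>2"
      using smoothed_ge [OF \<beta> yQ, of u] by simp
    moreover have "\<beta> / 2 * (norm (y - ydot))\<^sup>2 \<le> \<beta> / 2 * D\<^sup>2"
      using \<beta> yD by (intro mult_left_mono power_mono) auto
    ultimately have "h u \<le> smoothed \<beta> u + \<beta> / 2 * D\<^sup>2 + 2 * C * norm (u - v)" by linarith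
    also have "2 * C * norm (u - v) \<le> 2 * C * (\<epsilon> * D)" using C uv by (intro mult_left_mono) auto
    finally show ?thesis by (simp add: mult_ac)
  qed
  have "h u \<le> smoothed \<beta> u + \<beta> / 2 * D\<^sup>2"
  proof (rule field_le_epsilon)
    fix e :: real assume e: "0 < e"
    define \<epsilon> where "\<epsilon> = e / (2 * C * D + 1)"
    have pos: "0 < 2 * C * D + 1" using C D by (simp add: add_nonneg_pos)
    have "\<epsilon> * (2 * C * D) \<le> \<epsilon> * (2 * C * D + 1)" 
      using e pos by (intro mult_left_mono) (auto simp: \<epsilon>_def)
    also have "\<dots> = e" using pos by (simp add: \<epsilon>_def)
    finally show "h u \<le> smoothed \<beta> u + \<beta> / 2 * D\<^sup>2 + e"
      using approx [of \<epsilon>] e pos by (simp add: \<epsilon>_def)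
  qed
  then show ?thesis by (simp add: D_def)
qed

end

section \<open>Indicator of a point\<close>

lemma fenchel_conj_indicator: "fenchel_conj (indicator_fun {c}) y = ereal (c \<bullet> y)"
  unfolding fenchel_conj_def indicator_fun_def
  by (rule antisym [OF SUP_least SUP_upper2 [of c]]) auto

text \<open>
  The proximal point is always \<open>c\<close>.
\<close>

lemma smoothed_argmax_indicator:
  "0 < \<beta> \<Longrightarrow> smoothed_argmax (indicator_fun {c}) ydot \<beta> u = ydot + (1 / \<beta>) *\<^sub>R (u - c)"
  by (rule smoothed_argmax_prox_eq [where v = c and a = 0]) (simp_all add: fenchel_conj_indicator)

lemma smoothed_conjugate_indicator:
  "smoothed_conjugate (indicator_fun {c}) ydot UNIV (\<lambda>y. c \<bullet> y)"
proof
  fix \<beta> :: real and u y assume \<beta>: "0 < \<beta>"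
  note * = smoothed_argmax_prox_gap [where h = "indicator_fun {c}" and v = c and a = 0 and y = y, OF \<beta> refl]
  show "u \<bullet> y - c \<bullet> y - \<beta> / 2 * (norm (y - ydot))\<^sup>2
        + \<beta> / 2 * (norm (y - smoothed_argmax (indicator_fun {c}) ydot \<beta> u))\<^sup>2
      \<le> u \<bullet> smoothed_argmax (indicator_fun {c}) ydot \<beta> u
        - c \<bullet> smoothed_argmax (indicator_fun {c}) ydot \<beta> u
        - \<beta> / 2 * (norm (smoothed_argmax (indicator_fun {c}) ydot \<beta> u - ydot))\<^sup>2"
    using * [of ydot u] by (simp add: fenchel_conj_indicator smoothed_argmax_indicator [OF \<beta>])
qed simp

lemma smoothed_indicator:
  assumes \<beta>: "0 < \<beta>"
  shows "smoothed_conjugate.smoothed (indicator_fun {c}) ydot (\<lambda>y. c \<bullet> y) \<beta> u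
    = (u - c) \<bullet> ydot + (norm (u - c))\<^sup>2 / (2 * \<beta>)"
proof -
  have "(norm ((1 / \<beta>) *\<^sub>R (u - c)))\<^sup>2 = (norm (u - c))\<^sup>2 / \<beta>\<^sup>2"
    by (simp add: power_divide)
  moreover have "u \<bullet> (ydot + (1 / \<beta>) *\<^sub>R (u - c)) - c \<bullet> (ydot + (1 / \<beta>) *\<^sub>R (u - c))
    = (u - c) \<bullet> ydot + (norm (u - c))\<^sup>2 / \<beta>"
    by (simp add: power2_norm_eq_inner inner_add_right inner_diff_left diff_divide_distrib)
  ultimately show ?thesis
    unfolding smoothed_conjugate.smoothed_def [OF smoothed_conjugate_indicator]
      smoothed_argmax_indicator [OF \<beta>]
    using \<beta> by (simp add: field_simps power2_eq_square)
qed

section \<open>Parameter sequences\<close>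

lemma tau_L_root_ex1:
  fixes s :: real
  assumes "0 < s"
  shows "\<exists>!t. 0 < t \<and> t ^ 3 + t\<^sup>2 + s\<^sup>2 * t - s\<^sup>2 = 0"
proof -
  define p where "p t = t ^ 3 + t\<^sup>2 + s\<^sup>2 * t - s\<^sup>2" for t :: real
  have mono: "p t < p t'" if "0 \<le> t" "t < t'" for t t'
    using power_strict_mono [OF that(2,1), of 3] power_strict_mono [OF that(2,1), of 2] assms
      mult_strict_left_mono [OF that(2) zero_less_power [OF assms, of 2]]
    unfolding p_def by linarith
  have "\<exists>t\<ge>0. t \<le> 1 \<and> p t = 0"
    by (rule IVT') (use assms in \<open>auto simp: p_def intro!: continuous_intros\<close>)
  then obtain t where t: "0 \<le> t" "p t = 0" by blast
  then have "0 < t" using assms by (cases "t = 0") (auto simp: p_def)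
  moreover have "u = t" if "0 < u" "p u = 0" for u
    using mono [of t u] mono [of u t] that t by (cases u t rule: linorder_cases) auto
  ultimately show ?thesis using t(2) unfolding p_def by blast
qed

lemma tau_L_pos: "0 < tau_L k"
proof (induction k)
  case (Suc k)
  show ?case using theI' [OF tau_L_root_ex1 [OF Suc]] by simp
qed simp

lemma tau_L_root:
  "(tau_L (Suc k))\<^sup>2 * (1 + tau_L (Suc k)) = (1 - tau_L (Suc k)) * (tau_L k)\<^sup>2"
  using theI' [OF tau_L_root_ex1 [OF tau_L_pos [of k]]]
  by (simp add: algebra_simps power2_eq_square power3_eq_cube)

lemma tau_L_le_1: "tau_L k \<le> 1"
proof (cases k)
  case (Suc j)
  have "0 \<le> (1 - tau_L k) * (tau_L j)\<^sup>2"
    using tau_L_root [of j] tau_L_pos [of k] Suc by (metis add_pos_pos less_imp_le mult_pos_pos zero_less_one zero_less_power)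
  then show ?thesis using tau_L_pos [of j] by (simp add: zero_le_mult_iff)
qed simp

text \<open>
  With \<open>a = 1/(m + 1)\<close> the inequality reads \<open>m (m + 2) < (m + 1)\<^sup>2\<close>. It says that the cubic
  defining the next \<open>\<tau>\<close> is still negative at \<open>1/(m + 1)\<close> if the current one is \<open>1/m\<close>.
\<close>

lemma cubic_at_reciprocal: fixes m :: real assumes "0 < m" "a = 1 / (m + 1)"
  shows "a\<^sup>2 * (1 + a) < (1 - a) * (1 / m)\<^sup>2"
proof -
  have "a\<^sup>2 * (1 + a) = (m + 2) / (m + 1) ^ 3"
  proof -
    have "1 + a = (m + 2) / (m + 1)" using assms by (simp add: field_simps)
    then show ?thesis using assms by (simp add: power2_eq_square power3_eq_cube)
  qed
  also have "\<dots> < 1 / (m * (m + 1))"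
  proof -
    have "(m + 2) * (m * (m + 1)) < (m + 1) ^ 3" using assms
      by (simp add: power3_eq_cube algebra_simps)
    then show ?thesis using assms by (simp add: pos_divide_less_eq pos_less_divide_eq mult_pos_pos)
  qed
  also have "\<dots> = (1 - a) * (1 / m)\<^sup>2"
  proof -
    have "1 - a = m / (m + 1)" using assms by (simp add: field_simps)
    then show ?thesis using assms by (simp add: power2_eq_square)
  qed
  finally show ?thesis .
qed

lemma tau_L_ge: "1 / (real k + 1) \<le> tau_L k"
proof (induction k)
  case (Suc k)
  define t where "t = tau_L (Suc k)"
  define a where "a = 1 / (real k + 2)"
  have t0: "0 < t" "t \<le> 1" using tau_L_pos [of "Suc k"] tau_L_le_1 [of "Suc k"] by (auto simp: t_def)
  show ?case
  proof (rule ccontr)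
    assume "\<not> ?thesis"
    then have ta: "t < a" by (simp add: t_def a_def algebra_simps)
    have a: "0 < a" "a < 1" by (auto simp: a_def)
    \<comment> \<open>a root \<open>t < a\<close> would contradict \<open>cubic_at_reciprocal\<close> by monotonicity\<close>
    have "(1 - a) * (1 / (real k + 1))\<^sup>2 \<le> (1 - t) * (tau_L k)\<^sup>2"
      using Suc ta a t0 by (intro mult_mono power_mono) auto
    also have "\<dots> = t\<^sup>2 * (1 + t)" using tau_L_root [of k] by (simp add: t_def)
    also have "\<dots> \<le> a\<^sup>2 * (1 + a)"
      using ta t0 by (intro mult_mono power_mono) auto
    also have "\<dots> < (1 - a) * (1 / (real k + 1))\<^sup>2"
      by (rule cubic_at_reciprocal) (simp_all add: a_def)
    finally show False by simp
  qed
qed simp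

lemma beta_L_pos: "0 < b \<Longrightarrow> 0 < beta_L b k"
  by (induction k) (use tau_L_pos in \<open>auto simp del: tau_L.simps intro!: divide_pos_pos add_pos_pos\<close>)

lemma beta_L_le: "0 < b \<Longrightarrow> beta_L b k \<le> 2 * b / (real k + 2)"
proof (induction k)
  case (Suc k)
  have "beta_L b (Suc k) \<le> (2 * b / (real k + 2)) / (1 + 1 / (real (Suc k) + 1))"
    unfolding beta_L.simps
    by (rule frac_le) (use Suc tau_L_ge [of "Suc k"] in \<open>auto simp del: tau_L.simps intro: add_pos_pos\<close>)
  also have "\<dots> = 2 * b / (real (Suc k) + 2)" by (simp add: divide_simps)
  finally show ?case .
qed simp

lemma prod_tau_L_le: "(\<Prod>j=1..k. 1 - tau_L j) \<le> 1 / (real k + 1)"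
proof (induction k)
  case (Suc k)
  have "(\<Prod>j=1..Suc k. 1 - tau_L j) = (\<Prod>j=1..k. 1 - tau_L j) * (1 - tau_L (Suc k))" by simp
  also have "\<dots> \<le> 1 / (real k + 1) * (1 - 1 / (real (Suc k) + 1))"
    by (rule mult_mono) (use Suc tau_L_ge [of "Suc k"] tau_L_le_1 [of "Suc k"] in \<open>auto simp del: tau_L.simps\<close>)
  also have "\<dots> = 1 / (real (Suc k) + 1)" by (simp add: divide_simps)
  finally show ?case .
qed simp

lemma tau_C_eq: "tau_C k = 1 / (real k + 1)"
proof (induction k)
  case (Suc k)
  have "1 + 1 / (real k + 1) = (real k + 2) / (real k + 1)" by (simp add: field_simps)
  then show ?case by (simp add: Suc add.commute)
qed simp

lemma beta_C_eq: "beta_C b k = b / (real k + 1)"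
  by (induction k) (simp_all add: tau_C_eq field_simps del: tau_C.simps)

lemma prod_tau_C: "(\<Prod>j=1..k. 1 - tau_C j) = 1 / (real k + 1)"
  by (induction k) (simp_all add: tau_C_eq field_simps del: tau_C.simps)

lemma beta_L_decay:
  assumes "0 < b"
  shows "(1 - tau_L (Suc k)) * beta_L b k \<le> beta_L b (Suc k)"
proof -
  have "(1 - tau_L (Suc k)) * (1 + tau_L (Suc k)) \<le> 1" by (simp add: algebra_simps del: tau_L.simps)
  from mult_right_mono [OF this less_imp_le [OF beta_L_pos [OF assms]], of k]
  show ?thesis
    using tau_L_pos [of "Suc k"] by (simp add: pos_le_divide_eq add_pos_pos mult_ac del: tau_L.simps)
qed

lemma tau_L_decay: "(tau_L (Suc k))\<^sup>2 \<le> (1 - tau_L (Suc k)) * (tau_L k)\<^sup>2"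
proof -
  have "(tau_L (Suc k))\<^sup>2 * 1 \<le> (tau_L (Suc k))\<^sup>2 * (1 + tau_L (Suc k))"
    using tau_L_pos [of "Suc k"] by (intro mult_left_mono) auto
  then show ?thesis by (simp only: tau_L_root mult_1_right)
qed

lemma tau_L_beta_L_decay:
  "(tau_L (Suc k))\<^sup>2 * beta_L b k = (1 - tau_L (Suc k)) * (tau_L k)\<^sup>2 * beta_L b (Suc k)"
  unfolding tau_L_root [symmetric] using tau_L_pos [of "Suc k"] by (simp del: tau_L.simps)

lemma tau_C_decay: "(tau_C (Suc k))\<^sup>2 \<le> (1 - tau_C (Suc k)) * (tau_C k)\<^sup>2"
proof -
  have "1 - tau_C (Suc k) = (real k + 1) / (real k + 2)"
    unfolding tau_C_eq by (simp add: field_simps)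
  then have "(1 - tau_C (Suc k)) * (tau_C k)\<^sup>2 = 1 / ((real k + 2) * (real k + 1))"
    by (simp add: tau_C_eq power2_eq_square del: tau_C.simps)
  moreover have "(tau_C (Suc k))\<^sup>2 = 1 / ((real k + 2) * (real k + 2))"
    by (simp add: tau_C_eq power2_eq_square add.commute del: tau_C.simps)
  ultimately show ?thesis by (simp add: frac_le)
qed

lemma tau_C_beta_C_decay:
  "(tau_C (Suc k))\<^sup>2 * beta_C b k = (1 - tau_C (Suc k)) * (tau_C k)\<^sup>2 * beta_C b (Suc k)"
proof -
  have "tau_C (Suc k) = (1 - tau_C (Suc k)) * tau_C k"
    unfolding tau_C_eq by (simp add: field_simps)
  then have "(tau_C (Suc k))\<^sup>2 = (1 - tau_C (Suc k))\<^sup>2 * (tau_C k)\<^sup>2"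
    by (metis power_mult_distrib)
  then show ?thesis by (simp add: power2_eq_square del: tau_C.simps)
qed

section \<open>Convergence rates\<close>

text \<open>
  Completing the square.
\<close>

lemma le_of_quadratic_bound:
  fixes e :: real
  assumes \<beta>: "0 < \<beta>" and "0 \<le> a" and quad: "e\<^sup>2 / (2 * \<beta>) - d * e \<le> a"
  shows "e \<le> \<beta> * (d + sqrt (d\<^sup>2 + 2 * a / \<beta>))"
proof -
  have "e\<^sup>2 / (2 * \<beta>) - d * e = (e / \<beta> - d)\<^sup>2 * (\<beta> / 2) - d\<^sup>2 * (\<beta> / 2)"
    using \<beta> by (simp add: power2_eq_square field_simps)
  then have "(e / \<beta> - d)\<^sup>2 * (\<beta> / 2) \<le> (d\<^sup>2 + 2 * a / \<beta>) * (\<beta> / 2)"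
    using quad \<beta> by (simp add: distrib_right)
  then have "(e / \<beta> - d)\<^sup>2 \<le> d\<^sup>2 + 2 * a / \<beta>" using \<beta> by simp
  then have "e / \<beta> - d \<le> sqrt (d\<^sup>2 + 2 * a / \<beta>)" by (rule real_le_rsqrt)
  then show ?thesis using \<beta> by (simp add: field_simps)
qed

text \<open>
  The variance is nonnegative.
\<close>

lemma (in prob_space) expectation_square_le:
  assumes "integrable M X" "integrable M (\<lambda>\<omega>. (X \<omega>)\<^sup>2 :: real)"
  shows "(expectation X)\<^sup>2 \<le> expectation (\<lambda>\<omega>. (X \<omega>)\<^sup>2)"
  using variance_eq [OF assms] variance_positive [of X] by simp

theorem corollary3p5:
  fixes blk :: "'p::finite \<Rightarrow> 'n::finite"
    and H :: "'n \<Rightarrow> real^'p^'p"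
    and A :: "real^'p^'m::finite"
    and f :: "real^'p \<Rightarrow> real"
    and gf :: "real^'p \<Rightarrow> real^'p"
    and L :: "'n \<Rightarrow> real"
    and ydot :: "real^'m"
    and \<beta>1 \<alpha> :: real
    and x0 :: "real^'p"
    and M :: "'a measure"
    and I :: "nat \<Rightarrow> 'a \<Rightarrow> 'n"
  assumes blocks_nonempty: "surj blk"
    and H_spd: "\<forall>i. block_spd blk i (H i)"
    and f_convex: "convex_on UNIV f"
    and f_gradient: "\<forall>x. GDERIV f x :> gf x"
    and L_nonneg: "\<forall>i. 0 \<le> L i"
    and f_block_smooth: "\<forall>i x. \<forall>d\<in>block_space blk i.
          block_dual_norm blk i (H i) (block_part blk i (gf (x + d)) - block_part blk i (gf x))
            \<le> L i * block_norm (H i) d"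
    and \<beta>1_pos: "0 < \<beta>1"
    and \<alpha>_range: "0 \<le> \<alpha>" "\<alpha> \<le> 1"
    and B0_pos: "\<forall>i. 0 < B_coef blk H A L \<beta>1 i"
    and M_prob: "prob_space M"
    and draws_indep: "prob_space.indep_vars M (\<lambda>_. count_space UNIV) I UNIV"
    and draws_distr:
      "\<forall>k i. measure M {\<omega> \<in> space M. I k \<omega> = i} = sampling_prob blk H A L \<beta>1 \<alpha> i"
  shows
    "(\<forall>(h :: real^'m \<Rightarrow> real) xs.
        convex_on UNIV h \<and> closed (epigraph UNIV h) \<and> (\<exists>C. C-lipschitz_on UNIV h) \<and>
        is_arg_min (\<lambda>x. f x + h (A *v x)) (\<lambda>_. True) xs \<longrightarrow>
        (let F = (\<lambda>x. f x + h (A *v x));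
             eh = (\<lambda>u. ereal (h u));
             xbar = (\<lambda>k \<omega>. xbar_iter blk H A L gf eh ydot \<alpha> x0 tau_L (beta_L \<beta>1) (\<lambda>j. I j \<omega>) k);
             D = conj_dom_radius eh ydot
         in D < \<infinity> \<and>
            (\<forall>k\<ge>1. (\<integral>\<omega>. F (xbar k \<omega>) - F xs \<partial>M)
               \<le> 1 / real k * C_star blk H A L \<beta>1 \<alpha> xs x0
                 + \<beta>1 * (real_of_ereal D)\<^sup>2 / (real k + 1)))) \<and>
     (\<forall>c xs ys.
        is_arg_min f (\<lambda>x. A *v x = c) xs \<and>
        is_arg_max (dual_fun f A c) (\<lambda>_. True) ys \<and>
        dual_fun f A c ys = ereal (f xs) \<longrightarrow>
        (let xbar = (\<lambda>k \<omega>. xbar_iter blk H A L gf (indicator_fun {c}) ydot \<alpha> x0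
                              tau_C (beta_C \<beta>1) (\<lambda>j. I j \<omega>) k);
             C = C_star blk H A L \<beta>1 \<alpha> xs x0
         in \<forall>k\<ge>1.
              (\<integral>\<omega>. f (xbar k \<omega>) - f xs \<partial>M)
                \<le> C / real k + \<beta>1 * (norm (ys - ydot))\<^sup>2 / (2 * real k)
                  + norm ys * (\<integral>\<omega>. norm (A *v xbar k \<omega> - c) \<partial>M) \<and>
              (\<integral>\<omega>. norm (A *v xbar k \<omega> - c) \<partial>M)
                \<le> \<beta>1 / real k * (norm (ys - ydot) + sqrt ((norm (ys - ydot))\<^sup>2 + 2 / \<beta>1 * C))))"
proof (intro conjI allI impI)
  interpret prob_space M by (rule M_prob)
  have C_nonneg: "0 \<le> C_star blk H A L \<beta>1 \<alpha> xs x0" for xs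
    unfolding C_star_def using B0_pos by (intro sum_nonneg) (simp add: less_imp_le)
  {
    fix h :: "real^'m \<Rightarrow> real" and xs
    assume hyp: "convex_on UNIV h \<and> closed (epigraph UNIV h) \<and> (\<exists>C. C-lipschitz_on UNIV h) \<and>
      is_arg_min (\<lambda>x. f x + h (A *v x)) (\<lambda>_. True) xs"
    then obtain C where convex: "convex_on UNIV h" and lip: "C-lipschitz_on UNIV h" by blast
    define eh where "eh = (\<lambda>u. ereal (h u))"
    define hs where "hs = (\<lambda>y. real_of_ereal (fenchel_conj eh y))"
    define D where "D = real_of_ereal (conj_dom_radius eh ydot)"
    interpret randomized_smoothed_cd eh ydot "edom (fenchel_conj eh)" hs blk H A f gf L \<alpha> x0
      tau_L "beta_L \<beta>1" xs "h (A *v xs)" M I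
    proof (intro_locales)
      show "smoothed_conjugate eh ydot (edom (fenchel_conj eh)) hs"
        unfolding hs_def eh_def by (rule smoothed_conjugate_lipschitz [OF convex lip])
      show "smoothed_cd_axioms (edom (fenchel_conj eh)) hs blk H A f gf L tau_L (beta_L \<beta>1) xs (h (A *v xs))"
      proof
        show "(A *v xs) \<bullet> y - hs y \<le> h (A *v xs)" if "y \<in> edom (fenchel_conj eh)" for y
          using Fenchel_Young [OF convex lip that [unfolded eh_def]] unfolding hs_def eh_def .
      qed (use H_spd f_convex f_gradient L_nonneg f_block_smooth B0_pos tau_L_pos tau_L_le_1
            beta_L_pos [OF \<beta>1_pos] beta_L_decay [OF \<beta>1_pos] tau_L_decay tau_L_beta_L_decay
          in \<open>auto simp del: tau_L.simps(2) beta_L.simps(2)\<close>)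
      show "randomized_smoothed_cd_axioms blk H A L \<alpha> (beta_L \<beta>1) M I"
        by standard (use draws_indep draws_distr in auto)
    qed
    have bound: "(\<integral>\<omega>. f (fst (iter (\<lambda>j. I j \<omega>) k)) + h (A *v fst (iter (\<lambda>j. I j \<omega>) k))
          - (f xs + h (A *v xs)) \<partial>M)
        \<le> 1 / real k * C_star blk H A L \<beta>1 \<alpha> xs x0 + \<beta>1 * D\<^sup>2 / (real k + 1)" if "1 \<le> k" for k
    proof -
      obtain l where k: "k = Suc l" using \<open>1 \<le> k\<close> by (cases k) auto
      let ?x = "\<lambda>\<omega>. fst (iter (\<lambda>j. I j \<omega>) (Suc l))"
      let ?b = "beta_L \<beta>1 l"
      have "(\<integral>\<omega>. f (?x \<omega>) + h (A *v ?x \<omega>) - (f xs + h (A *v xs)) \<partial>M)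
          \<le> (\<integral>\<omega>. (smoothed_obj ?b (?x \<omega>) - fopt) + ?b / 2 * D\<^sup>2 \<partial>M)"
      proof (rule integral_mono)
        show "integrable M (\<lambda>\<omega>. f (?x \<omega>) + h (A *v ?x \<omega>) - (f xs + h (A *v xs)))"
          by (rule integrable_iter)
        show "integrable M (\<lambda>\<omega>. (smoothed_obj ?b (?x \<omega>) - fopt) + ?b / 2 * D\<^sup>2)"
          by (rule integrable_iter)
        show "f (?x \<omega>) + h (A *v ?x \<omega>) - (f xs + h (A *v xs))
            \<le> (smoothed_obj ?b (?x \<omega>) - fopt) + ?b / 2 * D\<^sup>2" for \<omega>
          using le_smoothed [OF convex lip beta_L_pos [OF \<beta>1_pos, of l], of "A *v ?x \<omega>" ydot]
          unfolding smoothed_obj_def fopt_def unfolding D_def hs_def eh_def by linarith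
      qed
      also have "\<dots> = (\<integral>\<omega>. smoothed_obj ?b (?x \<omega>) - fopt \<partial>M) + ?b / 2 * D\<^sup>2"
        by (subst Bochner_Integration.integral_add [OF integrable_iter]) (simp_all add: prob_space)
      also have "\<dots> \<le> 1 / (real l + 1) * C_star blk H A L \<beta>1 \<alpha> xs x0
          + (2 * \<beta>1 / (real l + 2)) / 2 * D\<^sup>2"
      proof (intro add_mono mult_right_mono divide_right_mono)
        have "(\<Prod>j=1..l. 1 - tau_L j) * C_star blk H A L \<beta>1 \<alpha> xs x0
            \<le> 1 / (real l + 1) * C_star blk H A L \<beta>1 \<alpha> xs x0"
          by (intro mult_right_mono prod_tau_L_le C_nonneg)
        then show "(\<integral>\<omega>. smoothed_obj ?b (?x \<omega>) - fopt \<partial>M)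
            \<le> 1 / (real l + 1) * C_star blk H A L \<beta>1 \<alpha> xs x0"
          by (rule order_trans [OF expected_smoothed_gap [of l, unfolded beta_L.simps(1)]])
      qed (use beta_L_le [OF \<beta>1_pos] in auto)
      also have "real l + 1 = real k" by (simp add: k)
      also have "2 * \<beta>1 / (real l + 2) / 2 * D\<^sup>2 = \<beta>1 * D\<^sup>2 / (real k + 1)"
      proof -
        have halve: "2 * a / s / 2 = a / s" for a s :: real by simp
        show ?thesis unfolding k halve by (simp add: add.commute)
      qed
      finally show ?thesis unfolding k .
    qed
    then show "let F = (\<lambda>x. f x + h (A *v x));
             eh = (\<lambda>u. ereal (h u));
             xbar = (\<lambda>k \<omega>. xbar_iter blk H A L gf eh ydot \<alpha> x0 tau_L (beta_L \<beta>1) (\<lambda>j. I j \<omega>) k);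
             D = conj_dom_radius eh ydot
         in D < \<infinity> \<and>
            (\<forall>k\<ge>1. (\<integral>\<omega>. F (xbar k \<omega>) - F xs \<partial>M)
               \<le> 1 / real k * C_star blk H A L \<beta>1 \<alpha> xs x0
                 + \<beta>1 * (real_of_ereal D)\<^sup>2 / (real k + 1))"
      using conj_dom_radius_finite [OF convex lip]
      by (simp only: Let_def xbar_iter_def D_def eh_def) blast
  next
    fix c :: "real^'m" and xs ys
    assume hyp: "is_arg_min f (\<lambda>x. A *v x = c) xs \<and>
        is_arg_max (dual_fun f A c) (\<lambda>_. True) ys \<and>
        dual_fun f A c ys = ereal (f xs)"
    then have xs: "A *v xs = c" by (simp add: is_arg_min_def)
    have dual: "f xs \<le> f x + (A *v x - c) \<bullet> ys" for x
    proof -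
      have "dual_fun f A c ys \<le> ereal (f x + (A *v x) \<bullet> ys - c \<bullet> ys)"
        unfolding dual_fun_def by (rule INF_lower) simp
      then show ?thesis using hyp by (simp add: inner_diff_left)
    qed
    define C where "C = C_star blk H A L \<beta>1 \<alpha> xs x0"
    define d where "d = norm (ys - ydot)"
    interpret randomized_smoothed_cd "indicator_fun {c}" ydot UNIV "\<lambda>y. c \<bullet> y" blk H A f gf L \<alpha> x0
      tau_C "beta_C \<beta>1" xs 0 M I
    proof (intro_locales)
      show "smoothed_conjugate (indicator_fun {c}) ydot UNIV (\<lambda>y. c \<bullet> y)"
        by (rule smoothed_conjugate_indicator)
      show "smoothed_cd_axioms UNIV (\<lambda>y. c \<bullet> y) blk H A f gf L tau_C (beta_C \<beta>1) xs 0"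
      proof
        show "(1 - tau_C (Suc k)) * beta_C \<beta>1 k \<le> beta_C \<beta>1 (Suc k)" for k
          unfolding beta_C.simps ..
        show "0 < tau_C k" "tau_C k \<le> 1" "0 < beta_C \<beta>1 k" for k
          using \<beta>1_pos by (simp_all add: tau_C_eq beta_C_eq)
      qed (use H_spd f_convex f_gradient L_nonneg f_block_smooth B0_pos tau_C_decay
            tau_C_beta_C_decay xs in \<open>auto simp del: tau_C.simps(2) beta_C.simps(2)\<close>)
      show "randomized_smoothed_cd_axioms blk H A L \<alpha> (beta_C \<beta>1) M I"
        by standard (use draws_indep draws_distr in auto)
    qed
    have bounds: "(\<integral>\<omega>. f (fst (iter (\<lambda>j. I j \<omega>) k)) - f xs \<partial>M)
          \<le> C / real k + \<beta>1 * d\<^sup>2 / (2 * real k)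
            + norm ys * (\<integral>\<omega>. norm (A *v fst (iter (\<lambda>j. I j \<omega>) k) - c) \<partial>M)
        \<and> (\<integral>\<omega>. norm (A *v fst (iter (\<lambda>j. I j \<omega>) k) - c) \<partial>M)
          \<le> \<beta>1 / real k * (d + sqrt (d\<^sup>2 + 2 / \<beta>1 * C))" if "1 \<le> k" for k
    proof -
      obtain l where k: "k = Suc l" using \<open>1 \<le> k\<close> by (cases k) auto
      define x where "x \<omega> = fst (iter (\<lambda>j. I j \<omega>) k)" for \<omega>
      define r where "r \<omega> = norm (A *v x \<omega> - c)" for \<omega>
      define b where "b = beta_C \<beta>1 l"
      have b: "0 < b" "b = \<beta>1 / real k"
        using \<beta>1_pos by (simp_all add: b_def beta_C_eq k add.commute)
      have int: "integrable M (\<lambda>\<omega>. \<Psi> (x \<omega>))" for \<Psi> :: "real^'p \<Rightarrow> real"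
        unfolding x_def by (rule integrable_iter)
      define gap where "gap \<omega> = smoothed_obj b (x \<omega>) - fopt" for \<omega>
      have "expectation gap \<le> 1 / (real l + 1) * C"
        using expected_smoothed_gap [of l]
        unfolding gap_def [abs_def] x_def k b_def C_def prod_tau_C beta_C.simps(1) .
      then have gap: "expectation gap \<le> C / real k" by (simp add: k add.commute)
      have int_gap: "integrable M gap" and int_r: "integrable M r"
        and int_r2: "integrable M (\<lambda>\<omega>. (r \<omega>)\<^sup>2)"
        unfolding gap_def [abs_def] r_def [abs_def] by (rule int)+
      \<comment> \<open>the dual solution is one competitor in the maximum defining the smoothed function\<close>
      have obj: "f (x \<omega>) - f xs \<le> gap \<omega> + b / 2 * d\<^sup>2 + norm ys * r \<omega>" for \<omega>
      proof -
        have "- ((A *v x \<omega> - c) \<bullet> ys) \<le> norm ys * r \<omega>"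
          using Cauchy_Schwarz_ineq2 [of "A *v x \<omega> - c" ys] by (simp add: r_def mult.commute)
        moreover have "(A *v x \<omega>) \<bullet> ys - c \<bullet> ys - b / 2 * d\<^sup>2 \<le> smoothed b (A *v x \<omega>)"
          unfolding d_def by (rule smoothed_ge [OF b(1)]) simp
        ultimately show ?thesis
          by (simp add: gap_def smoothed_obj_def fopt_def inner_diff_left)
      qed
      \<comment> \<open>the saddle point inequality bounds the objective gap below by a linear term in the residual\<close>
      have feas: "(r \<omega>)\<^sup>2 / (2 * b) - d * r \<omega> \<le> gap \<omega>" for \<omega>
      proof -
        have "(A *v x \<omega> - c) \<bullet> (ys - ydot) \<le> d * r \<omega>"
          using Cauchy_Schwarz_ineq2 [of "A *v x \<omega> - c" "ys - ydot"]
          by (simp add: r_def d_def mult.commute)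
        then show ?thesis
          using dual [of "x \<omega>"]
          by (simp add: gap_def smoothed_obj_def fopt_def smoothed_indicator [OF b(1)] r_def
              inner_diff_right)
      qed
      have "expectation (\<lambda>\<omega>. f (x \<omega>) - f xs)
          \<le> expectation (\<lambda>\<omega>. gap \<omega> + b / 2 * d\<^sup>2 + norm ys * r \<omega>)"
        by (rule integral_mono) (use int int_gap int_r obj in auto)
      also have "\<dots> = expectation gap + b / 2 * d\<^sup>2 + norm ys * expectation r"
        using int_gap int_r by (simp add: prob_space)
      also have "\<dots> \<le> C / real k + \<beta>1 * d\<^sup>2 / (2 * real k) + norm ys * expectation r"
        using gap by (simp add: b(2) mult.commute)
      finally have 1: "expectation (\<lambda>\<omega>. f (x \<omega>) - f xs)
          \<le> C / real k + \<beta>1 * d\<^sup>2 / (2 * real k) + norm ys * expectation r" .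
      have "(expectation r)\<^sup>2 / (2 * b) \<le> expectation (\<lambda>\<omega>. (r \<omega>)\<^sup>2) / (2 * b)"
        using b(1) by (intro divide_right_mono expectation_square_le int_r int_r2) auto
      then have "(expectation r)\<^sup>2 / (2 * b) - d * expectation r
          \<le> expectation (\<lambda>\<omega>. (r \<omega>)\<^sup>2 / (2 * b) - d * r \<omega>)"
        using int_r int_r2 by simp
      also have "\<dots> \<le> expectation gap"
        by (rule integral_mono) (use int_gap int_r int_r2 feas in auto)
      also note gap
      finally have "expectation r \<le> b * (d + sqrt (d\<^sup>2 + 2 * (C / real k) / b))"
        using C_nonneg [of xs] by (intro le_of_quadratic_bound b(1)) (simp_all add: C_def)
      also have "2 * (C / real k) / b = 2 / \<beta>1 * C"
        using \<open>1 \<le> k\<close> by (simp add: b(2))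
      finally have 2: "expectation r \<le> \<beta>1 / real k * (d + sqrt (d\<^sup>2 + 2 / \<beta>1 * C))"
        by (simp only: b(2))
      from 1 2 show ?thesis unfolding r_def [abs_def] x_def [abs_def] by blast
    qed
    then show "let xbar = (\<lambda>k \<omega>. xbar_iter blk H A L gf (indicator_fun {c}) ydot \<alpha> x0
                              tau_C (beta_C \<beta>1) (\<lambda>j. I j \<omega>) k);
             C = C_star blk H A L \<beta>1 \<alpha> xs x0
         in \<forall>k\<ge>1.
              (\<integral>\<omega>. f (xbar k \<omega>) - f xs \<partial>M)
                \<le> C / real k + \<beta>1 * (norm (ys - ydot))\<^sup>2 / (2 * real k)
                  + norm ys * (\<integral>\<omega>. norm (A *v xbar k \<omega> - c) \<partial>M) \<and>
              (\<integral>\<omega>. norm (A *v xbar k \<omega> - c) \<partial>M)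
                \<le> \<beta>1 / real k * (norm (ys - ydot) + sqrt ((norm (ys - ydot))\<^sup>2 + 2 / \<beta>1 * C))"
      by (simp only: Let_def xbar_iter_def C_def d_def) blast
  }
qed

end
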